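(* Let $(M^n,g)$, $n\ge 2$, be a Riemannian manifold of constant sectional curvature $-1$. Let $v_1,\dots,v_n$ be an orthonormal frame field locally defined on $M$ such that its dual forms $\theta_1,\dots,\theta_n$ and connection forms $\theta_{ij}$ satisfy: if $n=2$, $\theta_{12}+\theta_2=0$; if $n>2$, $\theta_{1i}+\theta_i=0$ for all $i\ge 2$ and $\theta_{ij}=0$ for all $i\ne j$, $2\le i,j\le n$. Then there exist local coordinates $y_1,\dots,y_n$ such that $$\frac{\partial}{\partial y_1}=v_1\qquad\text{and}\qquad \frac{\partial}{\partial y_i}=r_i v_i,\quad i\ge 2,$$ where each $r_i$ is a function of $y_1$ only.
   Context: Manifolds, metrics and frames are smooth. For a local orthonormal frame field $v_1,\dots,v_n$ on $(M^n,g)$ with Levi-Civita connection $\nabla$, the dual forms are the 1-forms $\theta_i$ with $\theta_i(v_j)=\delta_{ij}$, and the connection forms are $\theta_{ij}(X)=g(\nabla_X v_i,v_j)$, so $\theta_{ij}=-\theta_{ji}$ and $d\theta_i=\sum_{j\ne i}\theta_j\wedge\theta_{ji}$. "Local coordinates" means coordinates on some neighborhood of each given point of the domain of the frame. *)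

theory Defs
  imports "HOL-Analysis.Analysis"
begin

section \<open>Smooth maps between Euclidean spaces\<close>

text \<open>Intended for open \<open>S\<close> only: derivatives are taken in the full space.\<close>

fun differentiable_times_on ::
    "nat \<Rightarrow> ('a::euclidean_space \<Rightarrow> 'b::real_normed_vector) \<Rightarrow> 'a set \<Rightarrow> bool" where
  "differentiable_times_on 0 f S \<longleftrightarrow> continuous_on S f"
| "differentiable_times_on (Suc k) f S \<longleftrightarrow>
     (\<forall>x\<in>S. f differentiable (at x)) \<and>
     (\<forall>u. differentiable_times_on k (\<lambda>x. frechet_derivative f (at x) u) S)"

definition smooth_on :: "'a set \<Rightarrow> ('a::euclidean_space \<Rightarrow> 'b::real_normed_vector) \<Rightarrow> bool" where
  "smooth_on S f \<longleftrightarrow> (\<forall>k. differentiable_times_on k f S)"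


section \<open>Smooth manifolds\<close>

text \<open>A chart \<open>(U, \<phi>)\<close> is an open domain together with a map into \<open>\<real>\<^sup>n\<close>, where \<open>n = CARD('n)\<close>;
  the values of \<open>\<phi>\<close> outside \<open>U\<close> are irrelevant.  The manifold described by an atlas is the union
  of the domains of its charts, an open subset of the Hausdorff, second countable type \<open>'m\<close>.\<close>

type_synonym ('m, 'n) chart = "'m set \<times> ('m \<Rightarrow> real ^ 'n)"

definition is_chart :: "('m::topological_space, 'n::finite) chart \<Rightarrow> bool" where
  "is_chart c \<longleftrightarrow> (case c of (U, \<phi>) \<Rightarrow>
     open U \<and> open (\<phi> ` U) \<and> homeomorphism U (\<phi> ` U) \<phi> (inv_into U \<phi>))"

definition smooth_transition :: "('m, 'n::finite) chart \<Rightarrow> ('m, 'n) chart \<Rightarrow> bool" where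
  "smooth_transition c d \<longleftrightarrow> (case (c, d) of ((U, \<phi>), (V, \<psi>)) \<Rightarrow>
     smooth_on (\<phi> ` (U \<inter> V)) (\<psi> \<circ> inv_into U \<phi>))"

definition smooth_atlas ::
    "('m::{t2_space, second_countable_topology}, 'n::finite) chart set \<Rightarrow> bool" where
  "smooth_atlas A \<longleftrightarrow> (\<forall>c\<in>A. is_chart c) \<and> (\<forall>c\<in>A. \<forall>d\<in>A. smooth_transition c d)"

definition carrier_of :: "('m, 'n) chart set \<Rightarrow> 'm set" where
  "carrier_of A = \<Union> (fst ` A)"

text \<open>Smooth coordinate systems of the manifold: the charts of the maximal atlas containing \<open>A\<close>.\<close>

definition coordinate_chart ::
    "('m::topological_space, 'n::finite) chart set \<Rightarrow> ('m, 'n) chart \<Rightarrow> bool" where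
  "coordinate_chart A c \<longleftrightarrow> is_chart c \<and> fst c \<subseteq> carrier_of A \<and>
     (\<forall>d\<in>A. smooth_transition c d \<and> smooth_transition d c)"

definition smooth_fun ::
    "('m::topological_space, 'n::finite) chart set \<Rightarrow> 'm set \<Rightarrow> ('m \<Rightarrow> real) \<Rightarrow> bool" where
  "smooth_fun A U f \<longleftrightarrow> open U \<and> U \<subseteq> carrier_of A \<and>
     (\<forall>(V, \<phi>)\<in>A. smooth_on (\<phi> ` (U \<inter> V)) (f \<circ> inv_into V \<phi>))"

definition smooth_fun_at ::
    "('m::topological_space, 'n::finite) chart set \<Rightarrow> 'm \<Rightarrow> ('m \<Rightarrow> real) \<Rightarrow> bool" where
  "smooth_fun_at A p f \<longleftrightarrow> (\<exists>U. p \<in> U \<and> smooth_fun A U f)"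


section \<open>Tangent vectors and vector fields\<close>

text \<open>Tangent vectors at \<open>p\<close> are the directional derivatives at \<open>p\<close> in charts, regarded as operators
  on the functions that are smooth near \<open>p\<close>; they are set to 0 on all other functions, so that
  equality of tangent vectors is equality of HOL functions.\<close>

type_synonym 'm tvec = "('m \<Rightarrow> real) \<Rightarrow> real"

type_synonym 'm vfield = "'m \<Rightarrow> 'm tvec"

definition chart_vector ::
    "('m::topological_space, 'n::finite) chart set \<Rightarrow> ('m, 'n) chart \<Rightarrow> 'm \<Rightarrow> real ^ 'n \<Rightarrow> 'm tvec" where
  "chart_vector A c p u = (case c of (U, \<phi>) \<Rightarrow> (\<lambda>f.
     if smooth_fun_at A p f then frechet_derivative (f \<circ> inv_into U \<phi>) (at (\<phi> p)) u else 0))"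

definition coord_vector ::
    "('m::topological_space, 'n::finite) chart set \<Rightarrow> ('m, 'n) chart \<Rightarrow> 'n \<Rightarrow> 'm vfield" where
  "coord_vector A c i p = chart_vector A c p (axis i 1)"

definition tangent_space ::
    "('m::topological_space, 'n::finite) chart set \<Rightarrow> 'm \<Rightarrow> 'm tvec set" where
  "tangent_space A p = {chart_vector A c p u | c u. c \<in> A \<and> p \<in> fst c}"

text \<open>The function type \<open>'m tvec\<close> carries no vector space instance; these are the pointwise operations.\<close>

definition tadd :: "'m tvec \<Rightarrow> 'm tvec \<Rightarrow> 'm tvec" where
  "tadd w w' = (\<lambda>f. w f + w' f)"

definition tscale :: "real \<Rightarrow> 'm tvec \<Rightarrow> 'm tvec" where
  "tscale a w = (\<lambda>f. a * w f)"

definition tdiff :: "'m tvec \<Rightarrow> 'm tvec \<Rightarrow> 'm tvec" where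
  "tdiff w w' = (\<lambda>f. w f - w' f)"

definition tzero :: "'m tvec" where
  "tzero = (\<lambda>f. 0)"

definition linear_on_tangent ::
    "('m::topological_space, 'n::finite) chart set \<Rightarrow> 'm \<Rightarrow> ('m tvec \<Rightarrow> real) \<Rightarrow> bool" where
  "linear_on_tangent A p \<alpha> \<longleftrightarrow>
     (\<forall>w\<in>tangent_space A p. \<forall>w'\<in>tangent_space A p. \<alpha> (tadd w w') = \<alpha> w + \<alpha> w') \<and>
     (\<forall>a. \<forall>w\<in>tangent_space A p. \<alpha> (tscale a w) = a * \<alpha> w)"

definition vector_field ::
    "('m::topological_space, 'n::finite) chart set \<Rightarrow> 'm set \<Rightarrow> 'm vfield \<Rightarrow> bool" where
  "vector_field A U X \<longleftrightarrow> open U \<and> U \<subseteq> carrier_of A \<and> (\<forall>p\<in>U. X p \<in> tangent_space A p) \<and>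
     (\<forall>V f. V \<subseteq> U \<and> smooth_fun A V f \<longrightarrow> smooth_fun A V (\<lambda>p. X p f))"

definition vector_field_at ::
    "('m::topological_space, 'n::finite) chart set \<Rightarrow> 'm \<Rightarrow> 'm vfield \<Rightarrow> bool" where
  "vector_field_at A p X \<longleftrightarrow> (\<exists>U. p \<in> U \<and> vector_field A U X)"

definition lie_bracket ::
    "('m::topological_space, 'n::finite) chart set \<Rightarrow> 'm vfield \<Rightarrow> 'm vfield \<Rightarrow> 'm vfield" where
  "lie_bracket A X Y p = (\<lambda>f.
     if smooth_fun_at A p f then X p (\<lambda>q. Y q f) - Y p (\<lambda>q. X q f) else 0)"

definition one_form ::
    "('m::topological_space, 'n::finite) chart set \<Rightarrow> 'm set \<Rightarrow> ('m \<Rightarrow> 'm tvec \<Rightarrow> real) \<Rightarrow> bool" where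
  "one_form A U \<alpha> \<longleftrightarrow> open U \<and> U \<subseteq> carrier_of A \<and> (\<forall>p\<in>U. linear_on_tangent A p (\<alpha> p)) \<and>
     (\<forall>V X. V \<subseteq> U \<and> vector_field A V X \<longrightarrow> smooth_fun A V (\<lambda>p. \<alpha> p (X p)))"


section \<open>Riemannian metrics\<close>

type_synonym 'm metric = "'m \<Rightarrow> 'm tvec \<Rightarrow> 'm tvec \<Rightarrow> real"

definition riemannian_metric ::
    "('m::topological_space, 'n::finite) chart set \<Rightarrow> 'm metric \<Rightarrow> bool" where
  "riemannian_metric A g \<longleftrightarrow>
     (\<forall>p\<in>carrier_of A. \<forall>w\<in>tangent_space A p.
        linear_on_tangent A p (g p w) \<and>
        (\<forall>w'\<in>tangent_space A p. g p w w' = g p w' w) \<and>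
        (w \<noteq> tzero \<longrightarrow> g p w w > 0)) \<and>
     (\<forall>U X Y. vector_field A U X \<and> vector_field A U Y \<longrightarrow>
        smooth_fun A U (\<lambda>p. g p (X p) (Y p)))"

definition riemannian_manifold ::
    "('m::{t2_space, second_countable_topology}, 'n::finite) chart set \<Rightarrow> 'm metric \<Rightarrow> bool" where
  "riemannian_manifold A g \<longleftrightarrow> smooth_atlas A \<and> riemannian_metric A g"


section \<open>Levi-Civita connection and curvature\<close>

text \<open>\<open>nabla p w Y\<close> is the covariant derivative \<open>\<nabla>\<^sub>w Y\<close> at \<open>p\<close> of a vector field \<open>Y\<close> defined near \<open>p\<close>
  in the direction of a tangent vector \<open>w\<close> at \<open>p\<close>.\<close>

type_synonym 'm connection = "'m \<Rightarrow> 'm tvec \<Rightarrow> 'm vfield \<Rightarrow> 'm tvec"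

definition affine_connection ::
    "('m::topological_space, 'n::finite) chart set \<Rightarrow> 'm connection \<Rightarrow> bool" where
  "affine_connection A nabla \<longleftrightarrow>
     (\<forall>p Y. vector_field_at A p Y \<longrightarrow>
        (\<forall>w\<in>tangent_space A p. nabla p w Y \<in> tangent_space A p) \<and>
        (\<forall>w\<in>tangent_space A p. \<forall>w'\<in>tangent_space A p.
           nabla p (tadd w w') Y = tadd (nabla p w Y) (nabla p w' Y)) \<and>
        (\<forall>a. \<forall>w\<in>tangent_space A p. nabla p (tscale a w) Y = tscale a (nabla p w Y))) \<and>
     (\<forall>p Y Z. vector_field_at A p Y \<and> vector_field_at A p Z \<longrightarrow>
        (\<forall>w\<in>tangent_space A p.
           nabla p w (\<lambda>q. tadd (Y q) (Z q)) = tadd (nabla p w Y) (nabla p w Z))) \<and>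
     (\<forall>p Y f. vector_field_at A p Y \<and> smooth_fun_at A p f \<longrightarrow>
        (\<forall>w\<in>tangent_space A p.
           nabla p w (\<lambda>q. tscale (f q) (Y q)) = tadd (tscale (w f) (Y p)) (tscale (f p) (nabla p w Y)))) \<and>
     (\<forall>U X Y. vector_field A U X \<and> vector_field A U Y \<longrightarrow>
        vector_field A U (\<lambda>p. nabla p (X p) Y))"

definition levi_civita ::
    "('m::topological_space, 'n::finite) chart set \<Rightarrow> 'm metric \<Rightarrow> 'm connection \<Rightarrow> bool" where
  "levi_civita A g nabla \<longleftrightarrow> affine_connection A nabla \<and>
     (\<forall>p X Y. vector_field_at A p X \<and> vector_field_at A p Y \<longrightarrow>
        tdiff (nabla p (X p) Y) (nabla p (Y p) X) = lie_bracket A X Y p) \<and>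
     (\<forall>p Y Z. vector_field_at A p Y \<and> vector_field_at A p Z \<longrightarrow>
        (\<forall>w\<in>tangent_space A p.
           w (\<lambda>q. g q (Y q) (Z q)) = g p (nabla p w Y) (Z p) + g p (Y p) (nabla p w Z)))"

definition curvature_operator ::
    "('m::topological_space, 'n::finite) chart set \<Rightarrow> 'm connection \<Rightarrow>
     'm vfield \<Rightarrow> 'm vfield \<Rightarrow> 'm vfield \<Rightarrow> 'm vfield" where
  "curvature_operator A nabla X Y Z p =
     tdiff (tdiff (nabla p (X p) (\<lambda>q. nabla q (Y q) Z)) (nabla p (Y p) (\<lambda>q. nabla q (X q) Z)))
           (nabla p (lie_bracket A X Y p) Z)"

definition sectional_curvature ::
    "('m::topological_space, 'n::finite) chart set \<Rightarrow> 'm metric \<Rightarrow> 'm connection \<Rightarrow>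
     'm vfield \<Rightarrow> 'm vfield \<Rightarrow> 'm \<Rightarrow> real" where
  "sectional_curvature A g nabla X Y p =
     g p (curvature_operator A nabla X Y Y p) (X p) /
     (g p (X p) (X p) * g p (Y p) (Y p) - (g p (X p) (Y p))\<^sup>2)"

definition tangent_independent :: "'m tvec \<Rightarrow> 'm tvec \<Rightarrow> bool" where
  "tangent_independent w w' \<longleftrightarrow>
     (\<forall>a b. tadd (tscale a w) (tscale b w') = tzero \<longrightarrow> a = 0 \<and> b = 0)"

text \<open>A tangent plane at \<open>p\<close> is given by local vector fields whose values at \<open>p\<close> span it.\<close>

definition constant_sectional_curvature ::
    "('m::topological_space, 'n::finite) chart set \<Rightarrow> 'm metric \<Rightarrow> 'm connection \<Rightarrow> real \<Rightarrow> bool" where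
  "constant_sectional_curvature A g nabla \<kappa> \<longleftrightarrow>
     (\<forall>p X Y. vector_field_at A p X \<and> vector_field_at A p Y \<and> tangent_independent (X p) (Y p) \<longrightarrow>
        sectional_curvature A g nabla X Y p = \<kappa>)"


section \<open>Orthonormal frames\<close>

definition orthonormal_frame ::
    "('m::topological_space, 'n::finite) chart set \<Rightarrow> 'm metric \<Rightarrow> 'm set \<Rightarrow> ('n \<Rightarrow> 'm vfield) \<Rightarrow> bool" where
  "orthonormal_frame A g D v \<longleftrightarrow>
     (\<forall>i. vector_field A D (v i)) \<and>
     (\<forall>p\<in>D. \<forall>i j. g p (v i p) (v j p) = (if i = j then 1 else 0))"

definition dual_forms ::
    "('m::topological_space, 'n::finite) chart set \<Rightarrow> 'm set \<Rightarrow> ('n \<Rightarrow> 'm vfield) \<Rightarrow>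
     ('n \<Rightarrow> 'm \<Rightarrow> 'm tvec \<Rightarrow> real) \<Rightarrow> bool" where
  "dual_forms A D v \<theta> \<longleftrightarrow>
     (\<forall>i. one_form A D (\<theta> i)) \<and>
     (\<forall>p\<in>D. \<forall>i j. \<theta> i p (v j p) = (if i = j then 1 else 0))"

definition connection_form ::
    "'m metric \<Rightarrow> 'm connection \<Rightarrow> ('n \<Rightarrow> 'm vfield) \<Rightarrow> 'n \<Rightarrow> 'n \<Rightarrow> 'm \<Rightarrow> 'm tvec \<Rightarrow> real" where
  "connection_form g nabla v i j p w = g p (nabla p w (v i)) (v j p)"

end

theory Submission
  imports Defs
begin

text \<open>
  Write \<open>1\<close> for the distinguished index \<open>i1\<close>.  The hypotheses on the connection forms, together with
  \<open>\<theta>\<^sub>i\<^sub>j = - \<theta>\<^sub>j\<^sub>i\<close>, determine all of them: \<open>\<theta>\<^sub>i\<^sub>j = \<delta>\<^sub>j\<^sub>1 \<theta>\<^sub>i - \<delta>\<^sub>i\<^sub>1 \<theta>\<^sub>j\<close> (lemma \<open>connection_form_uniform\<close>).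
  Torsion-freeness then yields the brackets of the frame, \<open>[v\<^sub>i, v\<^sub>j] = \<delta>\<^sub>i\<^sub>1 v\<^sub>j - \<delta>\<^sub>j\<^sub>1 v\<^sub>i\<close>
  (lemma \<open>frame_bracket\<close>), or dually the structure equations \<open>d\<theta>\<^sub>k = - \<theta>\<^sub>1 \<and> \<theta>\<^sub>k\<close> (lemma
  \<open>structure_equation\<close>).

  For \<open>k = 1\<close> this says that \<open>\<theta>\<^sub>1\<close> is closed, so \<open>\<theta>\<^sub>1 = dy\<^sub>1\<close> locally.  For \<open>k \<noteq> 1\<close> the form
  \<open>exp(y\<^sub>1) \<theta>\<^sub>k\<close> is closed, since its differential is \<open>exp(y\<^sub>1) (\<theta>\<^sub>1 \<and> \<theta>\<^sub>k + d\<theta>\<^sub>k) = 0\<close>; hence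
  \<open>exp(y\<^sub>1) \<theta>\<^sub>k = dy\<^sub>k\<close> locally (lemma \<open>closed_form_has_potential\<close>).  The forms
  \<open>dy\<^sub>1, \<dots>, dy\<^sub>n\<close> are a basis at each point, so the \<open>y\<^sub>k\<close> are local coordinates by the inverse function
  theorem, and their coordinate fields are the frame dual to \<open>dy\<^sub>1, \<dots>, dy\<^sub>n\<close>, namely \<open>v\<^sub>1\<close> and
  \<open>exp(- y\<^sub>1) v\<^sub>k\<close> (lemmas \<open>local_coordinates_from_coframe\<close> and \<open>frame_coordinates\<close>).
  Thus \<open>r\<^sub>k = exp(- y\<^sub>1)\<close> for every \<open>k \<noteq> 1\<close>.

  The analysis takes place in the image of one chart, where vector fields and 1-forms become
  maps \<open>\<real>\<^sup>n \<Rightarrow> \<real>\<^sup>n\<close>, a 1-form acting by the inner product.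
\<close>

section \<open>Calculus of smooth maps on open sets\<close>

lemma differentiable_times_on_cong:
  assumes "open S" "\<And>x. x \<in> S \<Longrightarrow> f x = g x" "differentiable_times_on k f S"
  shows "differentiable_times_on k g S"
  using assms(2,3)
proof (induction k arbitrary: f g)
  case 0
  then show ?case by (metis continuous_on_cong differentiable_times_on.simps(1))
next
  case (Suc k)
  have diff: "f differentiable (at x)" if "x \<in> S" for x
    using Suc.prems(2) that by simp
  have eq: "frechet_derivative f (at x) = frechet_derivative g (at x)" if "x \<in> S" for x
    using frechet_derivative_transform_within_open[OF diff assms(1)] that Suc.prems(1) by blast
  have "g differentiable (at x)" if "x \<in> S" for x
    using diff[OF that] has_derivative_transform_within_open[where f = f and g = g, OF _ assms(1) that]
      Suc.prems(1) unfolding differentiable_def by blast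
  moreover have "differentiable_times_on k (\<lambda>x. frechet_derivative g (at x) u) S" for u
    using Suc.IH[of "\<lambda>x. frechet_derivative f (at x) u"] eq Suc.prems(2) by simp
  ultimately show ?case by simp
qed

text \<open>Any derivative may be used in place of the chosen one in the recursive definition.\<close>

lemma differentiable_times_on_SucI:
  assumes "open S" "\<And>x. x \<in> S \<Longrightarrow> (f has_derivative f' x) (at x)"
    "\<And>u. differentiable_times_on k (\<lambda>x. f' x u) S"
  shows "differentiable_times_on (Suc k) f S"
proof -
  have eq: "f' x = frechet_derivative f (at x)" if "x \<in> S" for x
    by (rule frechet_derivative_at) (rule assms(2)[OF that])
  have "differentiable_times_on k (\<lambda>x. frechet_derivative f (at x) u) S" for u
    by (rule differentiable_times_on_cong[OF assms(1) _ assms(3)[of u]]) (simp add: eq)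
  then show ?thesis using assms(2) by (auto simp: differentiable_def)
qed

lemma differentiable_times_on_SucD:
  assumes "differentiable_times_on (Suc k) f S"
  shows "\<And>x. x \<in> S \<Longrightarrow> (f has_derivative frechet_derivative f (at x)) (at x)"
    "\<And>u. differentiable_times_on k (\<lambda>x. frechet_derivative f (at x) u) S"
  using assms frechet_derivative_works by auto

lemma differentiable_times_on_Suc_imp:
  "differentiable_times_on (Suc k) f S \<Longrightarrow> differentiable_times_on k f S"
proof (induction k arbitrary: f)
  case 0
  then show ?case
    by (auto intro!: continuous_at_imp_continuous_on differentiable_imp_continuous_within)
next
  case (Suc k)
  then show ?case by (metis differentiable_times_on.simps(2))
qed

lemma differentiable_times_on_subset:
  "differentiable_times_on k f S \<Longrightarrow> T \<subseteq> S \<Longrightarrow> differentiable_times_on k f T"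
  by (induction k arbitrary: f) (auto intro: continuous_on_subset)

lemma differentiable_times_on_const:
  "differentiable_times_on k (\<lambda>x. c) S"
  by (induction k arbitrary: c) auto

lemma differentiable_times_on_bounded_linear:
  assumes "open S" "bounded_linear h" "differentiable_times_on k f S"
  shows "differentiable_times_on k (\<lambda>x. h (f x)) S"
  using assms(3)
proof (induction k arbitrary: f)
  case 0
  then show ?case using bounded_linear.continuous_on[OF assms(2)] by simp
next
  case (Suc k)
  note d = differentiable_times_on_SucD[OF Suc.prems]
  show ?case
    by (rule differentiable_times_on_SucI[OF assms(1)
          bounded_linear.has_derivative[OF assms(2) d(1)] Suc.IH[OF d(2)]])
qed

lemma differentiable_times_on_add:
  assumes "open S" "differentiable_times_on k f S" "differentiable_times_on k g S"
  shows "differentiable_times_on k (\<lambda>x. f x + g x) S"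
  using assms(2,3)
proof (induction k arbitrary: f g)
  case 0
  then show ?case by (simp add: continuous_on_add)
next
  case (Suc k)
  note d = differentiable_times_on_SucD[OF Suc.prems(1)] differentiable_times_on_SucD[OF Suc.prems(2)]
  show ?case
    by (rule differentiable_times_on_SucI[OF assms(1)
          has_derivative_add[OF d(1) d(3)] Suc.IH[OF d(2) d(4)]])
qed

lemma differentiable_times_on_sum:
  assumes "open S" "finite I" "\<And>i. i \<in> I \<Longrightarrow> differentiable_times_on k (f i) S"
  shows "differentiable_times_on k (\<lambda>x. \<Sum>i\<in>I. f i x) S"
  using assms(2,3)
  by (induction I rule: finite_induct)
    (auto intro: differentiable_times_on_const differentiable_times_on_add[OF assms(1)])

lemma differentiable_times_on_bilinear:
  assumes "open S" "bounded_bilinear h" "differentiable_times_on k f S" "differentiable_times_on k g S"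
  shows "differentiable_times_on k (\<lambda>x. h (f x) (g x)) S"
  using assms(3,4)
proof (induction k arbitrary: f g)
  case 0
  then show ?case using bounded_bilinear.continuous_on[OF assms(2)] by simp
next
  case (Suc k)
  note d = differentiable_times_on_SucD[OF Suc.prems(1)] differentiable_times_on_SucD[OF Suc.prems(2)]
  note lower = Suc.prems[THEN differentiable_times_on_Suc_imp]
  show ?case
    by (rule differentiable_times_on_SucI[OF assms(1)
          bounded_bilinear.FDERIV[OF assms(2) d(1) d(3)]
          differentiable_times_on_add[OF assms(1) Suc.IH[OF lower(1) d(4)] Suc.IH[OF d(2) lower(2)]]])
qed

lemma frechet_derivative_Basis_sum:
  fixes f :: "'a::euclidean_space \<Rightarrow> 'b::real_normed_vector"
  assumes "f differentiable (at x)"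
  shows "frechet_derivative f (at x) u = (\<Sum>b\<in>Basis. (u \<bullet> b) *\<^sub>R frechet_derivative f (at x) b)"
proof -
  have lin: "linear (frechet_derivative f (at x))"
    by (rule linear_frechet_derivative[OF assms])
  have "frechet_derivative f (at x) u = frechet_derivative f (at x) (\<Sum>b\<in>Basis. (u \<bullet> b) *\<^sub>R b)"
    by (simp add: euclidean_representation)
  also have "\<dots> = (\<Sum>b\<in>Basis. (u \<bullet> b) *\<^sub>R frechet_derivative f (at x) b)"
    by (simp add: linear_sum[OF lin] linear_scale[OF lin])
  finally show ?thesis .
qed

lemma differentiable_times_on_compose:
  assumes "open S" "open T" "f ` S \<subseteq> T"
    "differentiable_times_on k f S" "differentiable_times_on k g T"
  shows "differentiable_times_on k (\<lambda>x. g (f x)) S"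
  using assms(4,5)
proof (induction k arbitrary: g)
  case 0
  then show ?case using assms(3) by (auto intro: continuous_on_compose2)
next
  case (Suc k)
  note d = differentiable_times_on_SucD[OF Suc.prems(1)] differentiable_times_on_SucD[OF Suc.prems(2)]
  note lower = Suc.prems(1)[THEN differentiable_times_on_Suc_imp]
  have fT: "f x \<in> T" if "x \<in> S" for x using assms(3) that by auto
  have der: "((\<lambda>x. g (f x)) has_derivative
      (\<lambda>u. \<Sum>b\<in>Basis. (frechet_derivative f (at x) u \<bullet> b) *\<^sub>R frechet_derivative g (at (f x)) b)) (at x)"
    if "x \<in> S" for x
  proof -
    have "((\<lambda>x. g (f x)) has_derivative
        (\<lambda>u. frechet_derivative g (at (f x)) (frechet_derivative f (at x) u))) (at x)"
      using has_derivative_compose[OF d(1)[OF that] d(3)[OF fT[OF that]]] .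
    moreover have "g differentiable (at (f x))"
      using d(3)[OF fT[OF that]] by (auto simp: differentiable_def)
    ultimately show ?thesis by (simp add: frechet_derivative_Basis_sum[symmetric])
  qed
  show ?case
  proof (rule differentiable_times_on_SucI[OF assms(1) der])
    fix u
    show "differentiable_times_on k (\<lambda>x. \<Sum>b\<in>Basis.
        (frechet_derivative f (at x) u \<bullet> b) *\<^sub>R frechet_derivative g (at (f x)) b) S"
      by (intro differentiable_times_on_sum[OF assms(1)] finite_Basis
          differentiable_times_on_bilinear[OF assms(1) bounded_bilinear_scaleR]
          differentiable_times_on_bilinear[OF assms(1) bounded_bilinear_inner]
          d(2) differentiable_times_on_const Suc.IH lower d(4))
  qed
qed

lemma smooth_on_cong:
  "open S \<Longrightarrow> (\<And>x. x \<in> S \<Longrightarrow> f x = g x) \<Longrightarrow> smooth_on S f \<Longrightarrow> smooth_on S g"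
  unfolding smooth_on_def using differentiable_times_on_cong by blast

lemma smooth_on_subset: "smooth_on S f \<Longrightarrow> T \<subseteq> S \<Longrightarrow> smooth_on T f"
  unfolding smooth_on_def using differentiable_times_on_subset by blast

lemma smooth_on_const: "smooth_on S (\<lambda>x. c)"
  unfolding smooth_on_def using differentiable_times_on_const by blast

lemma smooth_on_bounded_linear:
  "open S \<Longrightarrow> bounded_linear h \<Longrightarrow> smooth_on S f \<Longrightarrow> smooth_on S (\<lambda>x. h (f x))"
  unfolding smooth_on_def using differentiable_times_on_bounded_linear by blast

lemma smooth_on_sum:
  "open S \<Longrightarrow> finite I \<Longrightarrow> (\<And>i. i \<in> I \<Longrightarrow> smooth_on S (f i)) \<Longrightarrow> smooth_on S (\<lambda>x. \<Sum>i\<in>I. f i x)"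
  unfolding smooth_on_def by (blast intro: differentiable_times_on_sum)

lemma smooth_on_bilinear:
  "open S \<Longrightarrow> bounded_bilinear h \<Longrightarrow> smooth_on S f \<Longrightarrow> smooth_on S g \<Longrightarrow>
    smooth_on S (\<lambda>x. h (f x) (g x))"
  unfolding smooth_on_def using differentiable_times_on_bilinear by blast

lemma smooth_on_compose:
  "open S \<Longrightarrow> open T \<Longrightarrow> f ` S \<subseteq> T \<Longrightarrow> smooth_on S f \<Longrightarrow> smooth_on T g \<Longrightarrow>
    smooth_on S (\<lambda>x. g (f x))"
  unfolding smooth_on_def using differentiable_times_on_compose by blast

lemma smooth_on_has_derivative:
  "smooth_on S f \<Longrightarrow> x \<in> S \<Longrightarrow> (f has_derivative frechet_derivative f (at x)) (at x)"
  unfolding smooth_on_def using differentiable_times_on_SucD(1) by blast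

lemma smooth_on_differentiable: "smooth_on S f \<Longrightarrow> x \<in> S \<Longrightarrow> f differentiable (at x)"
  using smooth_on_has_derivative differentiable_def by blast

lemma smooth_on_frechet_derivative:
  "smooth_on S f \<Longrightarrow> smooth_on S (\<lambda>x. frechet_derivative f (at x) u)"
  unfolding smooth_on_def using differentiable_times_on_SucD(2) by blast

lemma smooth_on_imp_continuous_on: "smooth_on S f \<Longrightarrow> continuous_on S f"
  unfolding smooth_on_def by (metis differentiable_times_on.simps(1))

text \<open>A bootstrapping rule: by induction on \<open>k\<close>, a function whose directional derivatives are smooth is
  \<open>k\<close> times differentiable for every \<open>k\<close>.\<close>

lemma smooth_onI:
  assumes "open S" "\<And>x. x \<in> S \<Longrightarrow> (f has_derivative f' x) (at x)"
    "\<And>u. smooth_on S (\<lambda>x. f' x u)"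
  shows "smooth_on S f"
proof -
  have "differentiable_times_on k f S" for k
    using assms(3) differentiable_times_on_Suc_imp[OF differentiable_times_on_SucI[OF assms(1,2)]]
    unfolding smooth_on_def by blast
  then show ?thesis by (simp add: smooth_on_def)
qed

lemma smooth_on_vec_nth:
  fixes f :: "'a::euclidean_space \<Rightarrow> real ^ 'n::finite"
  shows "open S \<Longrightarrow> smooth_on S f \<Longrightarrow> smooth_on S (\<lambda>x. f x $ k)"
  by (rule smooth_on_bounded_linear[OF _ bounded_linear_vec_nth])

lemma smooth_on_vec_lambda:
  fixes f :: "'n::finite \<Rightarrow> 'a::euclidean_space \<Rightarrow> real"
  assumes "open S" "\<And>k. smooth_on S (f k)"
  shows "smooth_on S (\<lambda>x. \<chi> k. f k x)"
proof -
  have "smooth_on S (\<lambda>x. \<Sum>k\<in>UNIV. f k x *\<^sub>R (axis k 1 :: real ^ 'n))"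
    by (intro smooth_on_sum smooth_on_bilinear[OF _ bounded_bilinear_scaleR] smooth_on_const assms) simp
  moreover have "(\<Sum>k\<in>UNIV. f k x *\<^sub>R (axis k 1 :: real ^ 'n)) = (\<chi> k. f k x)" for x
    using basis_expansion[of "\<chi> k. f k x"] by (simp add: scalar_mult_eq_scaleR)
  ultimately show ?thesis by simp
qed

lemma smooth_on_exp:
  fixes f :: "'a::euclidean_space \<Rightarrow> real"
  assumes "open S" "smooth_on S f"
  shows "smooth_on S (\<lambda>x. exp (f x))"
proof -
  have "differentiable_times_on k (\<lambda>x::real. exp x * c) UNIV" for k c
  proof (induction k arbitrary: c)
    case 0
    then show ?case by (simp add: continuous_intros)
  next
    case (Suc k)
    have "((\<lambda>x::real. exp x * c) has_derivative (\<lambda>u. exp x * (c * u))) (at x)" for x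
      by (auto intro!: derivative_eq_intros)
    then show ?case using differentiable_times_on_SucI[OF open_UNIV, of _ "\<lambda>x u. exp x * (c * u)"] Suc.IH
      by blast
  qed
  from this[of _ 1] have "smooth_on (UNIV::real set) exp" by (simp add: smooth_on_def)
  then show ?thesis by (rule smooth_on_compose[OF assms(1) open_UNIV _ assms(2), rotated]) simp
qed

section \<open>Closed one-forms and frames in Euclidean space\<close>

text \<open>The Poincare lemma for 1-forms.  The form \<open>u \<mapsto> t x \<bullet> u\<close> is closed if and only if its derivative is
  a symmetric bilinear form; a potential is the integral of the form along the segments from a
  fixed point \<open>x0\<close>, which is differentiated under the integral sign.\<close>

lemma closed_form_has_potential:
  fixes t :: "'a::euclidean_space \<Rightarrow> 'a"
  assumes S: "open S" "convex S" and t: "smooth_on S t"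
    and closed: "\<And>x u w. x \<in> S \<Longrightarrow>
      frechet_derivative t (at x) u \<bullet> w = frechet_derivative t (at x) w \<bullet> u"
  shows "\<exists>f::'a \<Rightarrow> real. smooth_on S f \<and> (\<forall>x\<in>S. (f has_derivative (\<lambda>u. t x \<bullet> u)) (at x))"
proof (cases "S = {}")
  case True
  then show ?thesis using smooth_on_const by auto
next
  case False
  then obtain x0 where x0: "x0 \<in> S" by blast
  define \<gamma> where "\<gamma> = (\<lambda>x s::real. x0 + s *\<^sub>R (x - x0))"
  have \<gamma>S: "\<gamma> x s \<in> S" if "x \<in> S" "s \<in> {0..1}" for x s
  proof -
    have "\<gamma> x s = (1 - s) *\<^sub>R x0 + s *\<^sub>R x" by (simp add: \<gamma>_def algebra_simps)
    then show ?thesis using that convexD[OF S(2) x0 that(1), of "1 - s" s] by simp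
  qed
  let ?Dt = "\<lambda>x. frechet_derivative t (at x)"
  have Dt: "(t has_derivative ?Dt x) (at x)" if "x \<in> S" for x
    using smooth_on_has_derivative[OF t that] .
  have linDt: "bounded_linear (?Dt x)" if "x \<in> S" for x
    using Dt[OF that] has_derivative_bounded_linear by blast
  have cont_t: "continuous_on S t" using smooth_on_imp_continuous_on[OF t] .
  have cont_Dt: "continuous_on S (\<lambda>x. ?Dt x u)" for u
    using smooth_on_imp_continuous_on[OF smooth_on_frechet_derivative[OF t]] .
  define F where "F = (\<lambda>x s. t (\<gamma> x s) \<bullet> (x - x0))"
  define F' where "F' = (\<lambda>x s. Blinfun (\<lambda>u. s * (?Dt (\<gamma> x s) u \<bullet> (x - x0)) + t (\<gamma> x s) \<bullet> u))"
  have F'_apply: "blinfun_apply (F' x s) =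
      (\<lambda>u. s * (?Dt (\<gamma> x s) u \<bullet> (x - x0)) + t (\<gamma> x s) \<bullet> u)"
    if "x \<in> S" "s \<in> {0..1}" for x s
    unfolding F'_def
    by (rule bounded_linear_Blinfun_apply, intro bounded_linear_add bounded_linear_const_mult
        bounded_linear_inner_left_comp[OF linDt[OF \<gamma>S[OF that]]] bounded_linear_inner_right)
  define f where "f = (\<lambda>x. integral (cbox 0 1) (F x))"
  have derF: "((\<lambda>x. F x s) has_derivative blinfun_apply (F' x s)) (at x within S)"
    if "x \<in> S" "s \<in> cbox 0 1" for x s
  proof -
    have s: "s \<in> {0..1}" using that by simp
    have "((\<lambda>x. \<gamma> x s) has_derivative (\<lambda>u. s *\<^sub>R u)) (at x within S)"
      unfolding \<gamma>_def by (auto intro!: derivative_eq_intros)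
    from has_derivative_compose[OF this Dt[OF \<gamma>S[OF that(1) s]]]
    have "((\<lambda>x. t (\<gamma> x s)) has_derivative (\<lambda>u. ?Dt (\<gamma> x s) (s *\<^sub>R u))) (at x within S)" .
    then have "((\<lambda>x. F x s) has_derivative
        (\<lambda>u. t (\<gamma> x s) \<bullet> u + ?Dt (\<gamma> x s) (s *\<^sub>R u) \<bullet> (x - x0))) (at x within S)"
      unfolding F_def by (auto intro!: derivative_eq_intros)
    moreover have "?Dt (\<gamma> x s) (s *\<^sub>R u) = s *\<^sub>R ?Dt (\<gamma> x s) u" for u
      using linDt[OF \<gamma>S[OF that(1) s]] by (simp add: bounded_linear.linear linear_scale)
    ultimately show ?thesis unfolding F'_apply[OF that(1) s] by (simp add: add.commute)
  qed
  have cont_\<gamma>: "continuous_on (S \<times> {0..1}) (\<lambda>z. \<gamma> (fst z) (snd z))"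
    unfolding \<gamma>_def by (intro continuous_intros)
  have cont_t\<gamma>: "continuous_on (S \<times> {0..1}) (\<lambda>z. t (\<gamma> (fst z) (snd z)))"
    by (rule continuous_on_compose2[OF cont_t cont_\<gamma>]) (auto intro: \<gamma>S)
  have cont_Dt\<gamma>: "continuous_on (S \<times> {0..1}) (\<lambda>z. ?Dt (\<gamma> (fst z) (snd z)) u)" for u
    by (rule continuous_on_compose2[OF cont_Dt cont_\<gamma>]) (auto intro: \<gamma>S)
  have cont_F': "continuous_on (S \<times> cbox 0 1) (\<lambda>(x, s). F' x s)"
  proof (rule continuous_on_blinfun_componentwise)
    fix u :: 'a
    have "continuous_on (S \<times> {0..1}) (\<lambda>z. snd z * (?Dt (\<gamma> (fst z) (snd z)) u \<bullet> (fst z - x0))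
        + t (\<gamma> (fst z) (snd z)) \<bullet> u)"
      by (intro continuous_intros cont_t\<gamma> cont_Dt\<gamma>)
    then show "continuous_on (S \<times> cbox 0 1) (\<lambda>z. blinfun_apply (case z of (x, s) \<Rightarrow> F' x s) u)"
      unfolding box_real by (rule continuous_on_eq) (auto simp: F'_apply)
  qed
  have cont_F: "continuous_on {0..1} (F x)" if "x \<in> S" for x
  proof -
    have "continuous_on {0..1} (\<gamma> x)"
      unfolding \<gamma>_def by (intro continuous_intros)
    then have "continuous_on {0..1} (\<lambda>s. t (\<gamma> x s))"
      by (rule continuous_on_compose2[OF cont_t]) (auto intro: \<gamma>S that)
    then show ?thesis unfolding F_def by (intro continuous_intros)
  qed
  have der: "(f has_derivative (\<lambda>u. t x \<bullet> u)) (at x)" if x: "x \<in> S" for x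
  proof -
    have "(f has_derivative blinfun_apply (integral (cbox 0 1) (F' x))) (at x within S)"
      unfolding f_def
      by (rule leibniz_rule[OF derF _ cont_F' x S(2)]) (auto intro: integrable_continuous_real cont_F)
    moreover have "blinfun_apply (integral (cbox 0 1) (F' x)) = (\<lambda>u. t x \<bullet> u)"
    proof
      fix u
      have "continuous_on (cbox 0 1) (\<lambda>s::real. (x, s))"
        by (rule continuous_on_Pair[OF continuous_on_const continuous_on_id])
      from continuous_on_compose2[OF cont_F' this] x
      have "continuous_on (cbox 0 1) (F' x)" by (simp add: image_subset_iff)
      then have "blinfun_apply (integral (cbox 0 1) (F' x)) u = integral (cbox 0 1) (\<lambda>s. F' x s u)"
        using blinfun_apply_integral integrable_continuous by blast
      also have "((\<lambda>s. F' x s u) has_integral (1 * (t (\<gamma> x 1) \<bullet> u) - 0 * (t (\<gamma> x 0) \<bullet> u))) {0..1}"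
      proof (rule fundamental_theorem_of_calculus)
        fix s :: real assume s: "s \<in> {0..1}"
        have "((\<lambda>s. \<gamma> x s) has_derivative (\<lambda>h. h *\<^sub>R (x - x0))) (at s within {0..1})"
          unfolding \<gamma>_def by (auto intro!: derivative_eq_intros)
        from has_derivative_compose[OF this Dt[OF \<gamma>S[OF x s]]]
        have "((\<lambda>s. t (\<gamma> x s)) has_derivative (\<lambda>h. h *\<^sub>R ?Dt (\<gamma> x s) (x - x0))) (at s within {0..1})"
          using linDt[OF \<gamma>S[OF x s]] by (simp add: bounded_linear.linear linear_scale)
        then have "((\<lambda>s. s * (t (\<gamma> x s) \<bullet> u)) has_derivative
            (\<lambda>h. h * (t (\<gamma> x s) \<bullet> u) + s * (h * (?Dt (\<gamma> x s) (x - x0) \<bullet> u)))) (at s within {0..1})"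
          by (auto intro!: derivative_eq_intros)
        \<comment> \<open>closedness turns the integrand into the derivative of \<open>s t(\<gamma>(s)) \<bullet> u\<close>\<close>
        then show "((\<lambda>s. s * (t (\<gamma> x s) \<bullet> u)) has_vector_derivative F' x s u) (at s within {0..1})"
          unfolding has_vector_derivative_def F'_apply[OF x s] closed[OF \<gamma>S[OF x s], of u "x - x0"]
          by (simp add: algebra_simps)
      qed simp
      then have "integral (cbox 0 1) (\<lambda>s. F' x s u) = t x \<bullet> u"
        by (auto dest!: integral_unique simp: \<gamma>_def)
      finally show "blinfun_apply (integral (cbox 0 1) (F' x)) u = t x \<bullet> u" .
    qed
    ultimately have "(f has_derivative (\<lambda>u. t x \<bullet> u)) (at x within S)" by simp
    then show ?thesis by (simp add: at_within_open[OF x S(1)])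
  qed
  have "smooth_on S f"
    by (rule smooth_onI[OF S(1) der])
      (auto intro: smooth_on_bilinear[OF S(1) bounded_bilinear_inner t smooth_on_const])
  with der show ?thesis by blast
qed

text \<open>If the partial derivatives of \<open>F\<close> are smooth functions of the value of \<open>F\<close>, then each degree of
  differentiability of \<open>F\<close> gives the next one.  For the inverse of a coordinate map these partial
  derivatives are the coordinate fields, and no smoothness of matrix inversion is needed.\<close>

lemma smooth_on_inverse_of_frame:
  fixes F :: "'a::euclidean_space \<Rightarrow> 'b::euclidean_space"
  assumes "open U" "open V" "F ` V \<subseteq> U"
    and der: "\<And>z. z \<in> V \<Longrightarrow> (F has_derivative F' z) (at z)"
    and F': "\<And>z b. z \<in> V \<Longrightarrow> b \<in> Basis \<Longrightarrow> F' z b = w b (F z)"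
    and w: "\<And>b. b \<in> Basis \<Longrightarrow> smooth_on U (w b)"
  shows "smooth_on V F"
proof -
  have der': "(F has_derivative (\<lambda>u. \<Sum>b\<in>Basis. (u \<bullet> b) *\<^sub>R w b (F z))) (at z)" if z: "z \<in> V" for z
  proof -
    have "F differentiable (at z)" using der[OF z] by (auto simp: differentiable_def)
    from frechet_derivative_Basis_sum[OF this]
    have "F' z u = (\<Sum>b\<in>Basis. (u \<bullet> b) *\<^sub>R w b (F z))" for u
      unfolding frechet_derivative_at[OF der[OF z], symmetric] by (simp add: F' z)
    then have "F' z = (\<lambda>u. \<Sum>b\<in>Basis. (u \<bullet> b) *\<^sub>R w b (F z))" by (rule ext)
    with der[OF z] show ?thesis by simp
  qed
  have "differentiable_times_on k F V" for k
  proof (induction k)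
    case 0
    have "continuous_on V F"
      using der by (meson continuous_at_imp_continuous_on has_derivative_continuous)
    then show ?case by simp
  next
    case (Suc k)
    have "differentiable_times_on k (\<lambda>z. w b (F z)) V" if "b \<in> Basis" for b
      using differentiable_times_on_compose[OF assms(2,1,3) Suc] w[OF that] by (auto simp: smooth_on_def)
    then show ?case
      by (intro differentiable_times_on_SucI[OF assms(2) der'] differentiable_times_on_sum[OF assms(2)]
          differentiable_times_on_bilinear[OF assms(2) bounded_bilinear_scaleR]
          differentiable_times_on_const) auto
  qed
  then show ?thesis by (simp add: smooth_on_def)
qed

text \<open>A one-sided inverse of a square matrix is two-sided.\<close>

lemma dual_basis_expansion:
  fixes a t :: "'n::finite \<Rightarrow> real ^ 'n"
  assumes "\<And>i j. t i \<bullet> a j = (if i = j then 1 else 0)"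
  shows "(\<Sum>i\<in>UNIV. (t i \<bullet> u) *\<^sub>R a i) = u"
proof -
  let ?A = "(\<chi> r c. a c $ r) :: real ^ 'n ^ 'n" and ?T = "(\<chi> i c. t i $ c) :: real ^ 'n ^ 'n"
  have "?T ** ?A = mat 1"
    using assms by (simp add: matrix_matrix_mult_def mat_def inner_vec_def)
  then have "?A ** ?T = mat 1" by (simp add: matrix_left_right_inverse)
  then have "u = ?A *v (?T *v u)" by (simp add: matrix_vector_mul_assoc)
  also have "\<dots> = (\<Sum>i\<in>UNIV. (t i \<bullet> u) *\<^sub>R a i)"
    by (simp add: vec_eq_iff matrix_vector_mult_def inner_vec_def mult.commute)
  finally show ?thesis by simp
qed

lemma linear_eq_on_frame:
  fixes a t :: "'n::finite \<Rightarrow> real ^ 'n" and f h :: "real ^ 'n \<Rightarrow> 'b::real_vector"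
  assumes "\<And>i j. t i \<bullet> a j = (if i = j then 1 else 0)"
    and "linear f" "linear h" "\<And>i. f (a i) = h (a i)"
  shows "f u = h u"
proof -
  have "f (\<Sum>i\<in>UNIV. (t i \<bullet> u) *\<^sub>R a i) = h (\<Sum>i\<in>UNIV. (t i \<bullet> u) *\<^sub>R a i)"
    by (simp add: linear_sum[OF assms(2)] linear_sum[OF assms(3)]
        linear_scale[OF assms(2)] linear_scale[OF assms(3)] assms(4))
  then show ?thesis by (simp add: dual_basis_expansion[OF assms(1)])
qed

text \<open>The equation \<open>dt\<^sub>k = - t\<^sub>1 \<and> t\<^sub>k\<close> for the coframe dual to a frame with
  \<open>[a\<^sub>i, a\<^sub>j] = \<delta>\<^sub>i\<^sub>1 a\<^sub>j - \<delta>\<^sub>j\<^sub>1 a\<^sub>i\<close>, evaluated on \<open>(u, w)\<close>.  Both sides are bilinear in \<open>(u, w)\<close>,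
  so that it suffices to compare them on the frame.\<close>

lemma structure_equation:
  fixes a t :: "'n::finite \<Rightarrow> real ^ 'n \<Rightarrow> real ^ 'n"
  assumes E: "open E"
    and a: "\<And>i. smooth_on E (a i)" and t: "\<And>i. smooth_on E (t i)"
    and dual: "\<And>i j x. x \<in> E \<Longrightarrow> t i x \<bullet> a j x = (if i = j then 1 else 0)"
    and bracket: "\<And>i j x. x \<in> E \<Longrightarrow>
      frechet_derivative (a j) (at x) (a i x) - frechet_derivative (a i) (at x) (a j x) =
      (if i = i1 then a j x else 0) - (if j = i1 then a i x else 0)"
    and x: "x \<in> E"
  shows "frechet_derivative (t k) (at x) u \<bullet> w - frechet_derivative (t k) (at x) w \<bullet> u =
    (t i1 x \<bullet> w) * (t k x \<bullet> u) - (t i1 x \<bullet> u) * (t k x \<bullet> w)"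
proof -
  let ?D = "\<lambda>f. frechet_derivative f (at x)"
  note dual' = dual[OF x]
  have linDt: "linear (?D (t k))"
    by (rule linear_frechet_derivative[OF smooth_on_differentiable[OF t x]])
  \<comment> \<open>differentiate the constant function \<open>t\<^sub>k \<bullet> a\<^sub>j\<close>\<close>
  have prod: "?D (t k) u \<bullet> a j x = - (t k x \<bullet> ?D (a j) u)" for j u
  proof -
    have "((\<lambda>x. t k x \<bullet> a j x) has_derivative (\<lambda>u. t k x \<bullet> ?D (a j) u + ?D (t k) u \<bullet> a j x)) (at x)"
      by (intro has_derivative_inner smooth_on_has_derivative[OF _ x] a t)
    moreover have "((\<lambda>x. t k x \<bullet> a j x) has_derivative (\<lambda>u. 0)) (at x)"
      by (rule has_derivative_transform_within_open[OF has_derivative_const E x]) (simp add: dual)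
    ultimately have "(\<lambda>u. t k x \<bullet> ?D (a j) u + ?D (t k) u \<bullet> a j x) = (\<lambda>u. 0)"
      using has_derivative_unique by blast
    then have "t k x \<bullet> ?D (a j) u + ?D (t k) u \<bullet> a j x = 0" by (rule fun_cong)
    then show ?thesis by simp
  qed
  let ?L = "\<lambda>u w. ?D (t k) u \<bullet> w - ?D (t k) w \<bullet> u"
    and ?R = "\<lambda>u w. (t i1 x \<bullet> w) * (t k x \<bullet> u) - (t i1 x \<bullet> u) * (t k x \<bullet> w)"
  have frame: "?L (a i x) (a j x) = ?R (a i x) (a j x)" for i j
  proof -
    have "?L (a i x) (a j x) = - (t k x \<bullet> (?D (a j) (a i x) - ?D (a i) (a j x)))"
      by (simp add: prod inner_diff_right)
    also have "\<dots> = ?R (a i x) (a j x)"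
      unfolding bracket[OF x] by (auto simp: dual' inner_diff_right)
    finally show ?thesis .
  qed
  have lin: "linear (\<lambda>u. ?L u w)" "linear (\<lambda>w. ?L u w)" "linear (\<lambda>u. ?R u w)" "linear (\<lambda>w. ?R u w)"
    for u w
    by (auto intro!: linearI simp: linear_add[OF linDt] linear_scale[OF linDt] algebra_simps
        inner_add_left inner_add_right)
  have "?L u (a j x) = ?R u (a j x)" for j
    by (rule linear_eq_on_frame[OF dual' lin(1) lin(3) frame])
  then show ?thesis
    by (rule linear_eq_on_frame[OF dual' lin(2) lin(4)])
qed

text \<open>If the members of a coframe \<open>s\<close> are the differentials of functions \<open>Y\<^sub>k\<close>, then the \<open>Y\<^sub>k\<close> are local
  coordinates whose coordinate fields form the dual frame \<open>w\<close>.\<close>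

lemma local_coordinates_from_coframe:
  fixes w s :: "'n::finite \<Rightarrow> real ^ 'n \<Rightarrow> real ^ 'n" and Y :: "'n \<Rightarrow> real ^ 'n \<Rightarrow> real"
  assumes B: "open B" "x0 \<in> B"
    and w: "\<And>i. smooth_on B (w i)" and s: "\<And>i. smooth_on B (s i)"
    and dual: "\<And>i j x. x \<in> B \<Longrightarrow> s i x \<bullet> w j x = (if i = j then 1 else 0)"
    and Y: "\<And>k x. x \<in> B \<Longrightarrow> (Y k has_derivative (\<lambda>u. s k x \<bullet> u)) (at x)"
  obtains U V F where "open U" "x0 \<in> U" "U \<subseteq> B" "open V"
    "homeomorphism U V (\<lambda>x. \<chi> k. Y k x) F" "smooth_on B (\<lambda>x. \<chi> k. Y k x)" "smooth_on V F"
    "\<And>z i. z \<in> V \<Longrightarrow> frechet_derivative F (at z) (axis i 1) = w i (F z)"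
proof -
  let ?Y = "\<lambda>x. \<chi> k. Y k x"
  define Y' where "Y' = (\<lambda>x. Blinfun (\<lambda>u. (\<chi> k. s k x \<bullet> u) :: real ^ 'n))"
  have bl: "bounded_linear (\<lambda>u. (\<chi> k. s k x \<bullet> u) :: real ^ 'n)" for x
    by (intro linear_conv_bounded_linear[THEN iffD1] linearI)
      (simp_all add: vec_eq_iff inner_add_right)
  have Y'_apply: "blinfun_apply (Y' x) = (\<lambda>u. \<chi> k. s k x \<bullet> u)" for x
    unfolding Y'_def by (rule bounded_linear_Blinfun_apply[OF bl])
  have frame: "blinfun_apply (Y' x) (w i x) = axis i 1" if "x \<in> B" for x i
    by (auto simp: Y'_apply vec_eq_iff axis_def dual[OF that])
  have derY: "(?Y has_derivative blinfun_apply (Y' x)) (at x)" if x: "x \<in> B" for x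
  proof -
    have "((\<lambda>x. ?Y x \<bullet> b) has_derivative (\<lambda>u. blinfun_apply (Y' x) u \<bullet> b)) (at x)" if b: "b \<in> Basis" for b
    proof -
      obtain k where b: "b = axis k 1" using b by (auto simp: Basis_vec_def Basis_real_def)
      show ?thesis using Y[OF x, of k] by (simp add: b inner_axis Y'_apply)
    qed
    then show ?thesis unfolding has_derivative_componentwise_within[of ?Y] by blast
  qed
  have "smooth_on B (Y k)" for k
    by (rule smooth_onI[OF B(1) Y])
      (auto intro: smooth_on_bilinear[OF B(1) bounded_bilinear_inner s smooth_on_const])
  then have smY: "smooth_on B ?Y" by (rule smooth_on_vec_lambda[OF B(1)])
  have contY': "continuous_on B Y'"
  proof (rule continuous_on_blinfun_componentwise)
    fix u :: "real ^ 'n"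
    have "continuous_on B (\<lambda>x. s k x \<bullet> u)" for k
      by (intro continuous_on_inner continuous_on_const smooth_on_imp_continuous_on s)
    then show "continuous_on B (\<lambda>x. blinfun_apply (Y' x) u)"
      unfolding Y'_apply by (rule continuous_on_vec_lambda)
  qed
  \<comment> \<open>by duality, \<open>N\<close> is the inverse of the derivative of the coordinate map at \<open>x0\<close>\<close>
  define N where "N = Blinfun (\<lambda>z :: real ^ 'n. \<Sum>i\<in>UNIV. (z $ i) *\<^sub>R w i x0)"
  have "bounded_linear (\<lambda>z :: real ^ 'n. \<Sum>i\<in>UNIV. (z $ i) *\<^sub>R w i x0)"
    by (intro bounded_linear_sum bounded_linear_scaleR_const bounded_linear_vec_nth)
  then have N_apply: "blinfun_apply N = (\<lambda>z. \<Sum>i\<in>UNIV. (z $ i) *\<^sub>R w i x0)"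
    unfolding N_def by (rule bounded_linear_Blinfun_apply)
  have "N o\<^sub>L Y' x0 = id_blinfun"
    by (rule blinfun_eqI) (simp add: N_apply Y'_apply dual_basis_expansion[of "\<lambda>i. s i x0" "\<lambda>i. w i x0"] dual[OF B(2)])
  from inverse_function_theorem[OF B(1) derY contY' B(2) this]
  obtain U V F F' where U: "open U" "U \<subseteq> B" "x0 \<in> U" and V: "open V" "?Y x0 \<in> V"
    and hom: "homeomorphism U V ?Y F"
    and derF: "\<And>z. z \<in> V \<Longrightarrow> (F has_derivative F' z) (at z)"
    and F': "\<And>z. z \<in> V \<Longrightarrow> F' z = inv (blinfun_apply (Y' (F z)))"
    and bij: "\<And>z. z \<in> V \<Longrightarrow> bij (blinfun_apply (Y' (F z)))" by metis
  have FV: "F ` V = U" using hom by (simp add: homeomorphism_def)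
  have F'_axis: "F' z (axis i 1) = w i (F z)" if z: "z \<in> V" for z i
  proof -
    have "F z \<in> B" using z FV U(2) by blast
    then show ?thesis unfolding F'[OF z] frame[symmetric, OF \<open>F z \<in> B\<close>]
      using bij[OF z] by (simp add: bij_is_inj)
  qed
  \<comment> \<open>the frame \<open>w\<close> indexed by the standard basis vectors instead of their indices\<close>
  define wb where "wb = (\<lambda>b :: real ^ 'n. w (THE i. b = axis i 1))"
  have "smooth_on V F"
  proof (rule smooth_on_inverse_of_frame[OF B(1) V(1) _ derF, where w = wb])
    show "F ` V \<subseteq> B" using FV U(2) by simp
    show "smooth_on B (wb b)" for b unfolding wb_def by (rule w)
    fix z b assume z: "z \<in> V" and "b \<in> (Basis :: (real ^ 'n) set)"
    then obtain k where b: "b = axis k 1" by (auto simp: Basis_vec_def Basis_real_def)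
    have "(THE i. b = axis i 1) = k" unfolding b by (auto simp: axis_eq_axis)
    then show "F' z b = wb b (F z)" using F'_axis[OF z, of k] by (simp add: wb_def b)
  qed
  moreover have "frechet_derivative F (at z) (axis i 1) = w i (F z)" if "z \<in> V" for z i
    using F'_axis[OF that] frechet_derivative_at[OF derF[OF that]] by simp
  ultimately show thesis using that U V hom smY by blast
qed

text \<open>A frame of \<open>\<real>\<^sup>n\<close> with \<open>[a\<^sub>i, a\<^sub>j] = \<delta>\<^sub>i\<^sub>1 a\<^sub>j - \<delta>\<^sub>j\<^sub>1 a\<^sub>i\<close> becomes, after all members except \<open>a\<^sub>1\<close> are
  multiplied by \<open>exp(- y\<^sub>1)\<close>, the coordinate frame of local coordinates \<open>y\<close>, here given by \<open>Y\<close> with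
  inverse \<open>F\<close>.\<close>

lemma frame_coordinates:
  fixes a t :: "'n::finite \<Rightarrow> real ^ 'n \<Rightarrow> real ^ 'n"
  assumes E: "open E" "x0 \<in> E"
    and a: "\<And>i. smooth_on E (a i)" and t: "\<And>i. smooth_on E (t i)"
    and dual: "\<And>i j x. x \<in> E \<Longrightarrow> t i x \<bullet> a j x = (if i = j then 1 else 0)"
    and bracket: "\<And>i j x. x \<in> E \<Longrightarrow>
      frechet_derivative (a j) (at x) (a i x) - frechet_derivative (a i) (at x) (a j x) =
      (if i = i1 then a j x else 0) - (if j = i1 then a i x else 0)"
  obtains U V Y F where "open U" "x0 \<in> U" "U \<subseteq> E" "open V"
    "homeomorphism U V Y F" "smooth_on U Y" "smooth_on V F"
    "\<And>z i. z \<in> V \<Longrightarrow> frechet_derivative F (at z) (axis i 1) =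
      (if i = i1 then 1 else exp (- (z $ i1))) *\<^sub>R a i (F z)"
proof -
  obtain e where e: "0 < e" "ball x0 e \<subseteq> E" using E open_contains_ball by blast
  define B where "B = ball x0 e"
  have B: "open B" "convex B" "x0 \<in> B" "B \<subseteq> E" using e by (auto simp: B_def)
  note aB = smooth_on_subset[OF a B(4)] and tB = smooth_on_subset[OF t B(4)]
  have struct: "frechet_derivative (t k) (at x) u \<bullet> w + (t i1 x \<bullet> u) * (t k x \<bullet> w) =
      frechet_derivative (t k) (at x) w \<bullet> u + (t i1 x \<bullet> w) * (t k x \<bullet> u)" if "x \<in> B" for x k u w
  proof -
    have "x \<in> E" using that B(4) by blast
    from structure_equation[of E a t i1, OF E(1) a t dual bracket this, of k u w]
    show ?thesis by linarith
  qed
  have Dt: "(t k has_derivative frechet_derivative (t k) (at x)) (at x)" if "x \<in> B" for k x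
    using smooth_on_has_derivative[OF tB that] .
  have "\<exists>f::real^'n \<Rightarrow> real. smooth_on B f \<and> (\<forall>x\<in>B. (f has_derivative (\<lambda>u. t i1 x \<bullet> u)) (at x))"
  proof (rule closed_form_has_potential[OF B(1,2) tB])
    fix x u w assume "x \<in> B"
    then show "frechet_derivative (t i1) (at x) u \<bullet> w = frechet_derivative (t i1) (at x) w \<bullet> u"
      using struct[of x i1 u w] by (simp add: mult.commute)
  qed
  then obtain y1 :: "real^'n \<Rightarrow> real" where y1: "smooth_on B y1"
    "\<And>x. x \<in> B \<Longrightarrow> (y1 has_derivative (\<lambda>u. t i1 x \<bullet> u)) (at x)" by blast
  \<comment> \<open>the rescaled coframe, all of whose members are closed, and its dual frame\<close>
  define s where "s = (\<lambda>k x. (if k = i1 then 1 else exp (y1 x)) *\<^sub>R t k x)"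
  define w where "w = (\<lambda>k x. (if k = i1 then 1 else exp (- y1 x)) *\<^sub>R a k x)"
  have exp_y1: "smooth_on B (\<lambda>x. exp (y1 x))" "smooth_on B (\<lambda>x. exp (- y1 x))"
    using smooth_on_bounded_linear[OF B(1) bounded_linear_minus[OF bounded_linear_ident] y1(1)]
    by (auto intro: smooth_on_exp[OF B(1)] y1)
  have smooth: "smooth_on B (s k)" "smooth_on B (w k)" for k
    unfolding s_def w_def using exp_y1
    by (cases "k = i1"; auto intro: smooth_on_bilinear[OF B(1) bounded_bilinear_scaleR] aB tB)+
  have dual': "s i x \<bullet> w j x = (if i = j then 1 else 0)" if "x \<in> B" for i j x
  proof -
    have "t i x \<bullet> a j x = (if i = j then 1 else 0)" using dual that B(4) by blast
    then show ?thesis by (auto simp: s_def w_def exp_minus)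
  qed
  have "\<exists>f::real^'n \<Rightarrow> real. smooth_on B f \<and> (\<forall>x\<in>B. (f has_derivative (\<lambda>u. s k x \<bullet> u)) (at x))"
    if k: "k \<noteq> i1" for k
  proof (rule closed_form_has_potential[OF B(1,2) smooth(1)])
    fix x u w assume x: "x \<in> B"
    have "(s k has_derivative (\<lambda>u. exp (y1 x) *\<^sub>R frechet_derivative (t k) (at x) u
        + (exp (y1 x) * (t i1 x \<bullet> u)) *\<^sub>R t k x)) (at x)"
      unfolding s_def using k by (auto intro!: derivative_eq_intros y1(2) Dt x)
    from frechet_derivative_at[OF this, symmetric]
    have Ds: "frechet_derivative (s k) (at x) u \<bullet> w =
        exp (y1 x) * (frechet_derivative (t k) (at x) u \<bullet> w + (t i1 x \<bullet> u) * (t k x \<bullet> w))" for u w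
      by (simp add: inner_add_left distrib_left)
    from struct[OF x, of k u w] show "frechet_derivative (s k) (at x) u \<bullet> w = frechet_derivative (s k) (at x) w \<bullet> u"
      by (simp add: Ds)
  qed
  then obtain y where y: "\<And>k x. k \<noteq> i1 \<Longrightarrow> x \<in> B \<Longrightarrow>
      ((y k :: real^'n \<Rightarrow> real) has_derivative (\<lambda>u. s k x \<bullet> u)) (at x)" by metis
  define Y where "Y = (\<lambda>k. if k = i1 then y1 else y k)"
  have "(Y k has_derivative (\<lambda>u. s k x \<bullet> u)) (at x)" if "x \<in> B" for k x
    using y1(2)[OF that] y[OF _ that, of k] by (auto simp: Y_def s_def)
  from local_coordinates_from_coframe[OF B(1,3) smooth(2,1) dual' this]
  obtain U V F where U: "open U" "x0 \<in> U" "U \<subseteq> B" and V: "open V"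
    and hom: "homeomorphism U V (\<lambda>x. \<chi> k. Y k x) F" and sm: "smooth_on B (\<lambda>x. \<chi> k. Y k x)" "smooth_on V F"
    and F': "\<And>z i. z \<in> V \<Longrightarrow> frechet_derivative F (at z) (axis i 1) = w i (F z)" by metis
  have "w i (F z) = (if i = i1 then 1 else exp (- (z $ i1))) *\<^sub>R a i (F z)" if "z \<in> V" for z i
  proof -
    have "y1 (F z) = (\<chi> k. Y k (F z)) $ i1" by (simp add: Y_def)
    also have "\<dots> = z $ i1" using homeomorphism_apply2[OF hom that] by simp
    finally show ?thesis by (simp add: w_def)
  qed
  with F' show thesis
    using that[OF U(1,2) _ V hom smooth_on_subset[OF sm(1) U(3)] sm(2)] U(3) B(4) by auto
qed

section \<open>Tangent vectors in a chart\<close>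

lemma is_chartD:
  assumes "is_chart (U, \<phi>)"
  shows "open U" "open (\<phi> ` U)" "homeomorphism U (\<phi> ` U) \<phi> (inv_into U \<phi>)"
    "\<And>q. q \<in> U \<Longrightarrow> inv_into U \<phi> (\<phi> q) = q"
  using assms by (auto simp: is_chart_def homeomorphism_def)

lemma is_chart_open_image:
  assumes "is_chart (U, \<phi>)" "open V"
  shows "open (\<phi> ` (U \<inter> V))" "open (\<phi> ` (V \<inter> U))"
proof -
  note c = is_chartD[OF assms(1)]
  have "openin (top_of_set U) (U \<inter> V)" using assms(2) by (simp add: openin_open_Int)
  from homeomorphism_imp_open_map[OF c(3) this] show "open (\<phi> ` (U \<inter> V))"
    using c(2) by (simp add: openin_open_eq)
  then show "open (\<phi> ` (V \<inter> U))" by (simp add: Int_commute)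
qed

lemma smooth_atlasD:
  assumes "smooth_atlas A" "(U, \<phi>) \<in> A"
  shows "is_chart (U, \<phi>)" "(V, \<psi>) \<in> A \<Longrightarrow> smooth_on (\<phi> ` (U \<inter> V)) (\<psi> \<circ> inv_into U \<phi>)"
    "U \<subseteq> carrier_of A"
  using assms by (force simp: smooth_atlas_def smooth_transition_def carrier_of_def)+

lemma smooth_fun_subset:
  assumes "smooth_fun A U f" "open V" "V \<subseteq> U"
  shows "smooth_fun A V f"
proof -
  have "smooth_on (\<phi> ` (V \<inter> W)) (f \<circ> inv_into W \<phi>)" if "(W, \<phi>) \<in> A" for W \<phi>
    by (rule smooth_on_subset[of "\<phi> ` (U \<inter> W)"]) (use assms that in \<open>auto simp: smooth_fun_def\<close>)
  then show ?thesis using assms by (auto simp: smooth_fun_def)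
qed

lemma smooth_fun_at_differentiable:
  assumes "smooth_fun_at A p f" "(U, \<phi>) \<in> A" "p \<in> U"
  shows "(f \<circ> inv_into U \<phi>) differentiable (at (\<phi> p))"
proof -
  obtain V where "p \<in> V" "smooth_fun A V f" using assms(1) by (auto simp: smooth_fun_at_def)
  then have "smooth_on (\<phi> ` (V \<inter> U)) (f \<circ> inv_into U \<phi>)"
    using assms(2) by (auto simp: smooth_fun_def)
  then show ?thesis using smooth_on_differentiable \<open>p \<in> V\<close> assms(3) by blast
qed

lemma linear_chart_derivative:
  assumes "smooth_fun_at A p f" "(U, \<phi>) \<in> A" "p \<in> U"
  shows "linear (frechet_derivative (f \<circ> inv_into U \<phi>) (at (\<phi> p)))"
  by (rule linear_frechet_derivative[OF smooth_fun_at_differentiable[OF assms]])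

lemma chart_vector_add:
  assumes "(U, \<phi>) \<in> A" "p \<in> U"
  shows "chart_vector A (U, \<phi>) p (u + w) = tadd (chart_vector A (U, \<phi>) p u) (chart_vector A (U, \<phi>) p w)"
  using linear_add[OF linear_chart_derivative[OF _ assms]]
  by (auto simp: chart_vector_def tadd_def fun_eq_iff)

lemma chart_vector_scale:
  assumes "(U, \<phi>) \<in> A" "p \<in> U"
  shows "chart_vector A (U, \<phi>) p (a *\<^sub>R u) = tscale a (chart_vector A (U, \<phi>) p u)"
  using linear_scale[OF linear_chart_derivative[OF _ assms]]
  by (auto simp: chart_vector_def tscale_def fun_eq_iff)

lemma chart_vector_diff:
  assumes "(U, \<phi>) \<in> A" "p \<in> U"
  shows "chart_vector A (U, \<phi>) p (u - w) = tdiff (chart_vector A (U, \<phi>) p u) (chart_vector A (U, \<phi>) p w)"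
  using linear_diff[OF linear_chart_derivative[OF _ assms]]
  by (auto simp: chart_vector_def tdiff_def fun_eq_iff)

text \<open>The chain rule for tangent vectors.  Of the two charts only \<open>(U, \<phi>)\<close> has to belong to the atlas, so
  that the lemma also applies to newly constructed coordinates \<open>(W, \<psi>)\<close>.\<close>

lemma chart_vector_change:
  assumes "(U, \<phi>) \<in> A" "is_chart (U, \<phi>)" "is_chart (W, \<psi>)" "smooth_transition (W, \<psi>) (U, \<phi>)"
    "p \<in> U" "p \<in> W"
  shows "chart_vector A (W, \<psi>) p u =
    chart_vector A (U, \<phi>) p (frechet_derivative (\<phi> \<circ> inv_into W \<psi>) (at (\<psi> p)) u)"
proof
  fix f
  let ?\<tau> = "\<phi> \<circ> inv_into W \<psi>"
  show "chart_vector A (W, \<psi>) p u f =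
      chart_vector A (U, \<phi>) p (frechet_derivative ?\<tau> (at (\<psi> p)) u) f"
  proof (cases "smooth_fun_at A p f")
    case True
    note c = is_chartD[OF assms(2)] and d = is_chartD[OF assms(3)]
    have sm: "smooth_on (\<psi> ` (W \<inter> U)) ?\<tau>" using assms(4) by (simp add: smooth_transition_def)
    have p: "\<psi> p \<in> \<psi> ` (W \<inter> U)" using assms(5,6) by blast
    have \<tau>p: "?\<tau> (\<psi> p) = \<phi> p" using d(4)[OF assms(6)] by simp
    have "((f \<circ> inv_into U \<phi>) has_derivative frechet_derivative (f \<circ> inv_into U \<phi>) (at (\<phi> p)))
        (at (?\<tau> (\<psi> p)))"
      using smooth_fun_at_differentiable[OF True assms(1,5)] unfolding \<tau>p frechet_derivative_works .
    from has_derivative_compose[OF smooth_on_has_derivative[OF sm p] this]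
    have "((f \<circ> inv_into W \<psi>) has_derivative (\<lambda>u. frechet_derivative (f \<circ> inv_into U \<phi>) (at (\<phi> p))
        (frechet_derivative ?\<tau> (at (\<psi> p)) u))) (at (\<psi> p))"
      by (rule has_derivative_transform_within_open[OF _ is_chart_open_image(1)[OF assms(3) c(1)] p])
        (auto simp: c(4) d(4))
    from fun_cong[OF frechet_derivative_at[OF this], of u] True show ?thesis
      by (simp add: chart_vector_def)
  qed (simp add: chart_vector_def)
qed

lemma tangent_space_eq_range_chart_vector:
  assumes "smooth_atlas A" "(U, \<phi>) \<in> A" "p \<in> U"
  shows "tangent_space A p = range (chart_vector A (U, \<phi>) p)"
proof -
  have "chart_vector A d p u \<in> range (chart_vector A (U, \<phi>) p)" if d: "d \<in> A" "p \<in> fst d" for d u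
  proof -
    obtain W \<psi> where [simp]: "d = (W, \<psi>)" by fastforce
    have "is_chart (W, \<psi>)" "smooth_transition (W, \<psi>) (U, \<phi>)"
      using assms(1,2) d(1) by (auto simp: smooth_atlas_def)
    then show ?thesis
      using chart_vector_change[OF assms(2) smooth_atlasD(1)[OF assms(1,2)] _ _ assms(3), of W \<psi> u] d(2) by simp
  qed
  then show ?thesis using assms(2,3) by (fastforce simp: tangent_space_def)
qed

lemma smooth_fun_coordinate:
  assumes "smooth_atlas A" "(U, \<phi>) \<in> A"
  shows "smooth_fun A U (\<lambda>q. \<phi> q $ k)"
proof -
  note c = is_chartD[OF smooth_atlasD(1)[OF assms]]
  have "smooth_on (\<psi> ` (U \<inter> V)) ((\<lambda>q. \<phi> q $ k) \<circ> inv_into V \<psi>)" if V: "(V, \<psi>) \<in> A" for V \<psi>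
  proof -
    have "smooth_on (\<psi> ` (V \<inter> U)) (\<lambda>x. (\<phi> \<circ> inv_into V \<psi>) x $ k)"
      by (rule smooth_on_vec_nth[OF is_chart_open_image(1)[OF smooth_atlasD(1)[OF assms(1) V] c(1)]
            smooth_atlasD(2)[OF assms(1) V assms(2)]])
    then show ?thesis by (simp add: Int_commute comp_def)
  qed
  then show ?thesis using c(1) smooth_atlasD(3)[OF assms] by (auto simp: smooth_fun_def)
qed

lemma chart_vector_coordinate:
  assumes "smooth_atlas A" "(U, \<phi>) \<in> A" "p \<in> U"
  shows "chart_vector A (U, \<phi>) p u (\<lambda>q. \<phi> q $ k) = u $ k"
proof -
  note c = is_chartD[OF smooth_atlasD(1)[OF assms(1,2)]]
  have "smooth_fun_at A p (\<lambda>q. \<phi> q $ k)"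
    using smooth_fun_coordinate[OF assms(1,2)] assms(3) by (auto simp: smooth_fun_at_def)
  moreover have "(((\<lambda>q. \<phi> q $ k) \<circ> inv_into U \<phi>) has_derivative (\<lambda>u. u $ k)) (at (\<phi> p))"
    by (rule has_derivative_transform_within_open[OF
          bounded_linear_imp_has_derivative[OF bounded_linear_vec_nth] c(2)])
      (use assms(3) c(4) in auto)
  from frechet_derivative_at[OF this, symmetric]
  have "frechet_derivative ((\<lambda>q. \<phi> q $ k) \<circ> inv_into U \<phi>) (at (\<phi> p)) u = u $ k" by simp
  ultimately show ?thesis by (simp add: chart_vector_def)
qed

lemma chart_vector_of_locally_constant:
  assumes "is_chart (U, \<phi>)" "open D" "p \<in> U" "p \<in> D" "\<And>q. q \<in> D \<Longrightarrow> f q = c"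
  shows "chart_vector A (U, \<phi>) p u f = 0"
proof -
  have "((f \<circ> inv_into U \<phi>) has_derivative (\<lambda>u. 0)) (at (\<phi> p))"
    by (rule has_derivative_transform_within_open[OF has_derivative_const
          is_chart_open_image(1)[OF assms(1,2)]])
      (use assms is_chartD(4)[OF assms(1)] in auto)
  from frechet_derivative_at[OF this, symmetric] show ?thesis by (simp add: chart_vector_def)
qed

lemma vector_field_chart_vector:
  assumes "smooth_atlas A" "(U, \<phi>) \<in> A" "open D" "D \<subseteq> U"
  shows "vector_field A D (\<lambda>q. chart_vector A (U, \<phi>) q u)"
  unfolding vector_field_def
proof (intro conjI ballI allI impI)
  note c = is_chartD[OF smooth_atlasD(1)[OF assms(1,2)]]
  show "open D" "D \<subseteq> carrier_of A" using assms smooth_atlasD(3)[OF assms(1,2)] by auto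
  show "chart_vector A (U, \<phi>) p u \<in> tangent_space A p" if "p \<in> D" for p
    using tangent_space_eq_range_chart_vector[OF assms(1,2)] that assms(4) by auto
  fix V f assume "V \<subseteq> D \<and> smooth_fun A V f"
  then have VD: "V \<subseteq> D" and f: "smooth_fun A V f" by auto
  have V: "open V" "V \<subseteq> carrier_of A" using f by (auto simp: smooth_fun_def)
  have at: "smooth_fun_at A q f" if "q \<in> V" for q using f that by (auto simp: smooth_fun_at_def)
  have "smooth_on (\<phi> ` (V \<inter> U)) (f \<circ> inv_into U \<phi>)"
    using f assms(2) by (auto simp: smooth_fun_def)
  note df = smooth_on_frechet_derivative[OF this, of u]
  have "smooth_on (\<psi> ` (V \<inter> W)) ((\<lambda>q. chart_vector A (U, \<phi>) q u f) \<circ> inv_into W \<psi>)"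
    if W: "(W, \<psi>) \<in> A" for W \<psi>
  proof -
    note cW = smooth_atlasD(1)[OF assms(1) W]
    note inv = is_chartD(4)[OF cW]
    note opn = is_chart_open_image(2)[OF cW V(1)]
    have "smooth_on (\<psi> ` (V \<inter> W)) (\<phi> \<circ> inv_into W \<psi>)"
      by (rule smooth_on_subset[OF smooth_atlasD(2)[OF assms(1) W assms(2)]]) (use VD assms(4) in auto)
    moreover have "(\<phi> \<circ> inv_into W \<psi>) ` \<psi> ` (V \<inter> W) \<subseteq> \<phi> ` (V \<inter> U)"
      using inv VD assms(4) by auto
    ultimately have "smooth_on (\<psi> ` (V \<inter> W))
        (\<lambda>x. frechet_derivative (f \<circ> inv_into U \<phi>) (at ((\<phi> \<circ> inv_into W \<psi>) x)) u)"
      using smooth_on_compose[OF opn is_chart_open_image(2)[OF smooth_atlasD(1)[OF assms(1,2)] V(1)] _ _ df]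
      by blast
    then show ?thesis
      by (rule smooth_on_cong[OF opn, rotated]) (auto simp: inv chart_vector_def at)
  qed
  then show "smooth_fun A V (\<lambda>q. chart_vector A (U, \<phi>) q u f)"
    using V by (auto simp: smooth_fun_def)
qed

text \<open>The coefficients of a vector field in a chart, as a function on the image of the chart: the
  component \<open>k\<close> is the derivative of the coordinate function \<open>k\<close> along the field.  This is meaningful
  only on the image of the part of the chart domain on which the field is defined.\<close>

definition chart_components :: "('m, 'n::finite) chart \<Rightarrow> 'm vfield \<Rightarrow> real ^ 'n \<Rightarrow> real ^ 'n" where
  "chart_components c X x = (\<chi> k. X (inv_into (fst c) (snd c) x) (\<lambda>q. snd c q $ k))"

lemma chart_vector_components:
  assumes "smooth_atlas A" "(U, \<phi>) \<in> A" "vector_field A D X" "q \<in> D" "q \<in> U"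
  shows "X q = chart_vector A (U, \<phi>) q (chart_components (U, \<phi>) X (\<phi> q))"
proof -
  have "X q \<in> tangent_space A q" using assms(3,4) by (auto simp: vector_field_def)
  then obtain u where u: "X q = chart_vector A (U, \<phi>) q u"
    using tangent_space_eq_range_chart_vector[OF assms(1,2,5)] by auto
  have "chart_components (U, \<phi>) X (\<phi> q) = u"
    using chart_vector_coordinate[OF assms(1,2,5), of u] is_chartD(4)[OF smooth_atlasD(1)[OF assms(1,2)] assms(5)]
    by (simp add: chart_components_def u vec_eq_iff)
  then show ?thesis by (simp add: u)
qed

lemma smooth_fun_component:
  assumes "smooth_atlas A" "(U, \<phi>) \<in> A" "vector_field A D X"
  shows "smooth_fun A (D \<inter> U) (\<lambda>q. X q (\<lambda>q. \<phi> q $ k))"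
proof -
  have "open (D \<inter> U)"
    using assms(3) is_chartD(1)[OF smooth_atlasD(1)[OF assms(1,2)]] by (auto simp: vector_field_def)
  with smooth_fun_subset[OF smooth_fun_coordinate[OF assms(1,2)]]
  show ?thesis using assms(3) by (auto simp: vector_field_def)
qed

lemma smooth_on_chart_components:
  assumes "smooth_atlas A" "(U, \<phi>) \<in> A" "vector_field A D X"
  shows "smooth_on (\<phi> ` (D \<inter> U)) (chart_components (U, \<phi>) X)"
proof -
  have "open D" using assms(3) by (simp add: vector_field_def)
  then have "open (\<phi> ` (D \<inter> U))" by (rule is_chart_open_image(2)[OF smooth_atlasD(1)[OF assms(1,2)]])
  moreover have "smooth_on (\<phi> ` (D \<inter> U)) (\<lambda>x. X (inv_into U \<phi> x) (\<lambda>q. \<phi> q $ k))" for k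
    using smooth_fun_component[OF assms, of k] assms(2) by (fastforce simp: smooth_fun_def comp_def Int_assoc)
  ultimately show ?thesis
    unfolding chart_components_def[abs_def] by (simp add: smooth_on_vec_lambda)
qed

lemma lie_bracket_coordinate:
  assumes "smooth_atlas A" "(U, \<phi>) \<in> A" "vector_field A D X" "vector_field A D Y" "q \<in> D" "q \<in> U"
  defines "a \<equiv> chart_components (U, \<phi>) X" and "b \<equiv> chart_components (U, \<phi>) Y"
  shows "lie_bracket A X Y q (\<lambda>q. \<phi> q $ k) =
    (frechet_derivative b (at (\<phi> q)) (a (\<phi> q)) - frechet_derivative a (at (\<phi> q)) (b (\<phi> q))) $ k"
proof -
  have q: "\<phi> q \<in> \<phi> ` (D \<inter> U)" using assms(5,6) by blast
  have *: "X q (\<lambda>q. Y q (\<lambda>q. \<phi> q $ k)) =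
      frechet_derivative (chart_components (U, \<phi>) Y) (at (\<phi> q)) (chart_components (U, \<phi>) X (\<phi> q)) $ k"
    if X: "vector_field A D X" and Y: "vector_field A D Y" for X Y
  proof -
    let ?h = "\<lambda>q. Y q (\<lambda>q. \<phi> q $ k)" and ?b = "chart_components (U, \<phi>) Y"
    have "smooth_fun_at A q ?h"
      using smooth_fun_component[OF assms(1,2) Y] assms(5,6) unfolding smooth_fun_at_def by blast
    moreover have "?h \<circ> inv_into U \<phi> = (\<lambda>x. ?b x $ k)"
      by (simp add: chart_components_def comp_def)
    moreover have "(?b has_derivative frechet_derivative ?b (at (\<phi> q))) (at (\<phi> q))"
      by (rule smooth_on_has_derivative[OF smooth_on_chart_components[OF assms(1,2) Y] q])
    from bounded_linear.has_derivative[OF bounded_linear_vec_nth this, of k]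
    have "frechet_derivative (\<lambda>x. ?b x $ k) (at (\<phi> q)) = (\<lambda>u. frechet_derivative ?b (at (\<phi> q)) u $ k)"
      using frechet_derivative_at by metis
    ultimately show ?thesis
      unfolding chart_vector_components[OF assms(1,2) X assms(5,6)] by (simp add: chart_vector_def)
  qed
  have "smooth_fun_at A q (\<lambda>q. \<phi> q $ k)"
    using smooth_fun_coordinate[OF assms(1,2)] assms(6) by (auto simp: smooth_fun_at_def)
  then show ?thesis
    using *[OF assms(3,4)] *[OF assms(4,3)] by (simp add: lie_bracket_def a_def b_def)
qed

text \<open>Composing a chart \<open>\<phi>\<close> with a diffeomorphism \<open>Y\<close> defined on an open part \<open>N\<close> of its image gives a
  smooth coordinate system.  Its tangent vectors are expressed in the old chart by the derivative of
  the inverse \<open>F\<close> of \<open>Y\<close>.\<close>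

lemma coordinate_chart_compose:
  assumes A: "smooth_atlas A" "(U, \<phi>) \<in> A"
    and N: "open N" "N \<subseteq> \<phi> ` U" "open V" "homeomorphism N V Y F"
    and sm: "smooth_on N Y" "smooth_on V F"
  defines "W \<equiv> inv_into U \<phi> ` N"
  shows "coordinate_chart A (W, Y \<circ> \<phi>)" "W \<subseteq> U" "\<And>q. q \<in> W \<Longrightarrow> \<phi> q \<in> N"
    "\<And>q u. q \<in> W \<Longrightarrow> chart_vector A (W, Y \<circ> \<phi>) q u =
       chart_vector A (U, \<phi>) q (frechet_derivative F (at (Y (\<phi> q))) u)"
    "\<And>q. q \<in> W \<Longrightarrow> Y (\<phi> q) \<in> V" "\<And>q. q \<in> W \<Longrightarrow> F (Y (\<phi> q)) = \<phi> q"
proof -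
  let ?\<psi> = "Y \<circ> \<phi>"
  note c = is_chartD[OF smooth_atlasD(1)[OF A]]
  have \<phi>inv: "\<phi> (inv_into U \<phi> x) = x" if "x \<in> N" for x
    using N(2) that f_inv_into_f by (metis subsetD)
  show WU: "W \<subseteq> U" using N(2) by (auto simp: W_def inv_into_into)
  show WO: "\<phi> q \<in> N" if "q \<in> W" for q using that \<phi>inv by (auto simp: W_def)
  show WV: "Y (\<phi> q) \<in> V" if "q \<in> W" for q
    using WO[OF that] N(4) by (auto simp: homeomorphism_def)
  show FY: "F (Y (\<phi> q)) = \<phi> q" if "q \<in> W" for q
    using WO[OF that] N(4) by (auto simp: homeomorphism_def)
  have "homeomorphism N W (inv_into U \<phi>) \<phi>"
    by (rule homeomorphism_of_subsets[OF homeomorphism_symD[OF c(3)] N(2) WU]) (simp add: W_def)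
  then have hom: "homeomorphism W V ?\<psi> (inv_into U \<phi> \<circ> F)"
    by (rule homeomorphism_compose[OF homeomorphism_symD N(4)])
  have \<psi>W: "?\<psi> ` W = V" using hom by (simp add: homeomorphism_def)
  have inj: "inj_on ?\<psi> W" using hom by (metis homeomorphism_apply1 inj_on_inverseI)
  have inv\<psi>: "inv_into W ?\<psi> z = inv_into U \<phi> (F z)" if "z \<in> V" for z
  proof -
    have "inv_into U \<phi> (F z) \<in> W" "?\<psi> (inv_into U \<phi> (F z)) = z"
      using hom that by (auto simp: homeomorphism_def)
    then show ?thesis using inv_into_f_f[OF inj] by metis
  qed
  have FV: "F z \<in> N" if "z \<in> V" for z using N(4) that by (auto simp: homeomorphism_def)
  have \<phi>inv\<psi>: "\<phi> (inv_into W ?\<psi> z) = F z" if "z \<in> V" for z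
    using inv\<psi>[OF that] \<phi>inv[OF FV[OF that]] by simp
  have "openin (top_of_set U) W"
    unfolding W_def
    by (rule homeomorphism_imp_open_map[OF homeomorphism_symD[OF c(3)]]) (use N(1,2) in \<open>simp add: open_subset\<close>)
  then have openW: "open W" using c(1) by (simp add: openin_open_eq)
  have "homeomorphism W (?\<psi> ` W) ?\<psi> (inv_into W ?\<psi>)"
    unfolding \<psi>W by (rule homeomorphism_cong[OF hom]) (auto simp: inv\<psi>)
  then have chart: "is_chart (W, ?\<psi>)"
    unfolding is_chart_def using openW \<psi>W N(3) by simp
  have to: "smooth_transition (W, ?\<psi>) (X, \<eta>)" if X: "(X, \<eta>) \<in> A" for X \<eta>
  proof -
    note d = is_chartD[OF smooth_atlasD(1)[OF A(1) X]]
    note opn = is_chart_open_image(1)[OF chart d(1)]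
    have sub: "?\<psi> ` (W \<inter> X) \<subseteq> V" using \<psi>W by blast
    have "F ` ?\<psi> ` (W \<inter> X) \<subseteq> \<phi> ` (U \<inter> X)" using FY WU by auto
    from smooth_on_compose[OF opn is_chart_open_image(1)[OF smooth_atlasD(1)[OF A] d(1)] this
        smooth_on_subset[OF sm(2) sub] smooth_atlasD(2)[OF A X]]
    have "smooth_on (?\<psi> ` (W \<inter> X)) (\<lambda>z. (\<eta> \<circ> inv_into U \<phi>) (F z))" .
    then show ?thesis unfolding smooth_transition_def prod.case
      by (rule smooth_on_cong[OF opn, rotated]) (use sub inv\<psi> in auto)
  qed
  moreover have "smooth_transition (X, \<eta>) (W, ?\<psi>)" if X: "(X, \<eta>) \<in> A" for X \<eta>
  proof -
    note cX = smooth_atlasD(1)[OF A(1) X]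
    note opn = is_chart_open_image(1)[OF cX openW]
    have "(\<phi> \<circ> inv_into X \<eta>) ` \<eta> ` (X \<inter> W) \<subseteq> N" using is_chartD(4)[OF cX] WO by auto
    moreover have "smooth_on (\<eta> ` (X \<inter> W)) (\<phi> \<circ> inv_into X \<eta>)"
      by (rule smooth_on_subset[OF smooth_atlasD(2)[OF A(1) X A(2)]]) (use WU in auto)
    ultimately have "smooth_on (\<eta> ` (X \<inter> W)) (\<lambda>z. Y ((\<phi> \<circ> inv_into X \<eta>) z))"
      using smooth_on_compose[OF opn N(1) _ _ sm(1)] by blast
    then show ?thesis by (simp add: smooth_transition_def comp_def)
  qed
  ultimately show "coordinate_chart A (W, ?\<psi>)"
    using chart WU smooth_atlasD(3)[OF A] by (auto simp: coordinate_chart_def)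
  show "chart_vector A (W, ?\<psi>) q u =
      chart_vector A (U, \<phi>) q (frechet_derivative F (at (Y (\<phi> q))) u)" if q: "q \<in> W" for q u
  proof -
    have "(F has_derivative frechet_derivative F (at (Y (\<phi> q)))) (at (Y (\<phi> q)))"
      by (rule smooth_on_has_derivative[OF sm(2) WV[OF q]])
    then have "((\<phi> \<circ> inv_into W ?\<psi>) has_derivative frechet_derivative F (at (Y (\<phi> q)))) (at (Y (\<phi> q)))"
      by (rule has_derivative_transform_within_open[OF _ N(3) WV[OF q]]) (simp add: \<phi>inv\<psi>)
    from frechet_derivative_at[OF this]
    show ?thesis
      using chart_vector_change[OF A(2) smooth_atlasD(1)[OF A] chart to[OF A(2)] _ q, of u] WU q by auto
  qed
qed

section \<open>Frames with the prescribed connection forms\<close>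

text \<open>The coefficients of a 1-form in a chart, as a function on the image of the chart: its values on
  the coordinate fields.  Like \<open>chart_components\<close>, they matter only where the form is defined.\<close>

definition form_components ::
    "('m::topological_space, 'n::finite) chart set \<Rightarrow> ('m, 'n) chart \<Rightarrow> ('m \<Rightarrow> 'm tvec \<Rightarrow> real) \<Rightarrow>
     real ^ 'n \<Rightarrow> real ^ 'n" where
  "form_components A c \<alpha> x =
     (let q = inv_into (fst c) (snd c) x in \<chi> l. \<alpha> q (chart_vector A c q (axis l 1)))"

lemma linear_form_chart_vector:
  assumes "smooth_atlas A" "(U, \<phi>) \<in> A" "q \<in> U" "linear_on_tangent A q \<alpha>"
  shows "linear (\<lambda>u. \<alpha> (chart_vector A (U, \<phi>) q u))"
proof -
  have "chart_vector A (U, \<phi>) q u \<in> tangent_space A q" for u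
    using tangent_space_eq_range_chart_vector[OF assms(1-3)] by blast
  then show ?thesis
    using assms(4) by (intro linearI)
      (auto simp: linear_on_tangent_def chart_vector_add[OF assms(2,3)] chart_vector_scale[OF assms(2,3)])
qed

lemma form_components_inner:
  assumes "smooth_atlas A" "(U, \<phi>) \<in> A" "one_form A D \<alpha>" "q \<in> D" "q \<in> U"
  shows "form_components A (U, \<phi>) \<alpha> (\<phi> q) \<bullet> u = \<alpha> q (chart_vector A (U, \<phi>) q u)"
proof -
  let ?f = "\<lambda>u. \<alpha> q (chart_vector A (U, \<phi>) q u)"
  have lin: "linear ?f"
    by (rule linear_form_chart_vector[OF assms(1,2,5)]) (use assms(3,4) in \<open>simp add: one_form_def\<close>)
  have "?f u = ?f (\<Sum>l\<in>UNIV. (u $ l) *\<^sub>R axis l 1)"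
    using basis_expansion[of u] by (simp add: scalar_mult_eq_scaleR)
  also have "\<dots> = (\<Sum>l\<in>UNIV. (u $ l) * ?f (axis l 1))"
    by (simp add: linear_sum[OF lin] linear_scale[OF lin])
  finally show ?thesis
    using is_chartD(4)[OF smooth_atlasD(1)[OF assms(1,2)] assms(5)]
    by (simp add: form_components_def inner_vec_def mult.commute)
qed

lemma smooth_on_form_components:
  assumes "smooth_atlas A" "(U, \<phi>) \<in> A" "one_form A D \<alpha>"
  shows "smooth_on (\<phi> ` (D \<inter> U)) (form_components A (U, \<phi>) \<alpha>)"
proof -
  note c = smooth_atlasD(1)[OF assms(1,2)]
  have D: "open D" using assms(3) by (simp add: one_form_def)
  have "smooth_on (\<phi> ` (D \<inter> U))
      (\<lambda>x. \<alpha> (inv_into U \<phi> x) (chart_vector A (U, \<phi>) (inv_into U \<phi> x) (axis l 1)))" for l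
  proof -
    have "open (D \<inter> U)" using D is_chartD(1)[OF c] by blast
    from vector_field_chart_vector[OF assms(1,2) this]
    have "smooth_fun A (D \<inter> U) (\<lambda>q. \<alpha> q (chart_vector A (U, \<phi>) q (axis l 1)))"
      using assms(3) by (auto simp: one_form_def)
    then show ?thesis using assms(2) by (fastforce simp: smooth_fun_def comp_def Int_assoc)
  qed
  from smooth_on_vec_lambda[OF is_chart_open_image(2)[OF c D] this]
  show ?thesis by (simp add: form_components_def[abs_def] Let_def)
qed

lemma frame_components_dual:
  assumes "smooth_atlas A" "(U, \<phi>) \<in> A" "orthonormal_frame A g D v" "dual_forms A D v \<theta>"
    "q \<in> D" "q \<in> U"
  shows "form_components A (U, \<phi>) (\<theta> i) (\<phi> q) \<bullet> chart_components (U, \<phi>) (v j) (\<phi> q) =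
    (if i = j then 1 else 0)"
proof -
  have "one_form A D (\<theta> i)" "vector_field A D (v j)" "\<theta> i q (v j q) = (if i = j then 1 else 0)"
    using assms by (auto simp: orthonormal_frame_def dual_forms_def)
  then show ?thesis
    by (simp add: form_components_inner[OF assms(1,2) _ assms(5,6)]
        chart_vector_components[OF assms(1,2) _ assms(5,6), symmetric])
qed

text \<open>Both sides are linear in \<open>w\<close> and agree on the frame, which spans the tangent space because it has
  \<open>n\<close> members and a dual family of forms.\<close>

lemma dual_form_eq_metric:
  assumes "smooth_atlas A" "riemannian_metric A g" "orthonormal_frame A g D v" "dual_forms A D v \<theta>"
    "p \<in> D" "w \<in> tangent_space A p"
  shows "\<theta> k p w = g p w (v k p)"
proof -
  have v: "vector_field A D (v i)" for i using assms(3) by (simp add: orthonormal_frame_def)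
  have "p \<in> carrier_of A" using v[of k] assms(5) by (auto simp: vector_field_def)
  then obtain U \<phi> where U: "(U, \<phi>) \<in> A" "p \<in> U" by (auto simp: carrier_of_def)
  note tan = tangent_space_eq_range_chart_vector[OF assms(1) U]
  have vk: "v k p \<in> tangent_space A p" using v assms(5) by (auto simp: vector_field_def)
  have met: "linear_on_tangent A p (g p (v k p))" "w \<in> tangent_space A p \<Longrightarrow> g p (v k p) w = g p w (v k p)" for w
    using assms(2) \<open>p \<in> carrier_of A\<close> vk by (auto simp: riemannian_metric_def)
  have lin\<theta>: "linear_on_tangent A p (\<theta> k p)" using assms(4,5) by (auto simp: dual_forms_def one_form_def)
  have "\<theta> k p (chart_vector A (U, \<phi>) p u) = g p (v k p) (chart_vector A (U, \<phi>) p u)" for u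
  proof (rule linear_eq_on_frame[OF frame_components_dual[OF assms(1) U(1) assms(3,4,5) U(2)]
        linear_form_chart_vector[OF assms(1) U lin\<theta>] linear_form_chart_vector[OF assms(1) U met(1)]])
    fix i
    show "\<theta> k p (chart_vector A (U, \<phi>) p (chart_components (U, \<phi>) (v i) (\<phi> p))) =
        g p (v k p) (chart_vector A (U, \<phi>) p (chart_components (U, \<phi>) (v i) (\<phi> p)))"
      unfolding chart_vector_components[OF assms(1) U(1) v assms(5) U(2), symmetric]
      using assms(3,4,5) by (auto simp: orthonormal_frame_def dual_forms_def)
  qed
  then show ?thesis using met(2) assms(6) tan by auto
qed

text \<open>Metric compatibility, applied to the constant functions \<open>g(v\<^sub>i, v\<^sub>j)\<close>.\<close>

lemma connection_form_skew:
  assumes "smooth_atlas A" "riemannian_metric A g" "levi_civita A g nabla" "orthonormal_frame A g D v"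
    "p \<in> D" "w \<in> tangent_space A p"
  shows "connection_form g nabla v i j p w = - connection_form g nabla v j i p w"
proof -
  have v: "vector_field A D (v i)" for i using assms(4) by (simp add: orthonormal_frame_def)
  then have at: "vector_field_at A p (v i)" for i using assms(5) by (auto simp: vector_field_at_def)
  have D: "open D" "p \<in> carrier_of A" using v[of i] assms(5) by (auto simp: vector_field_def)
  then obtain U \<phi> where U: "(U, \<phi>) \<in> A" "p \<in> U" by (auto simp: carrier_of_def)
  obtain u where u: "w = chart_vector A (U, \<phi>) p u"
    using tangent_space_eq_range_chart_vector[OF assms(1) U] assms(6) by auto
  have "w (\<lambda>q. g q (v i q) (v j q)) = 0"
    unfolding u
    by (rule chart_vector_of_locally_constant[OF smooth_atlasD(1)[OF assms(1) U(1)] D(1) U(2) assms(5)])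
      (use assms(4) in \<open>auto simp: orthonormal_frame_def\<close>)
  moreover have "w (\<lambda>q. g q (v i q) (v j q)) =
      g p (nabla p w (v i)) (v j p) + g p (v i p) (nabla p w (v j))"
    using assms(3,6) at by (auto simp: levi_civita_def)
  moreover have "nabla p w (v j) \<in> tangent_space A p"
    using assms(3,6) at by (auto simp: levi_civita_def affine_connection_def)
  moreover have "v i p \<in> tangent_space A p" using v assms(5) by (auto simp: vector_field_def)
  ultimately show ?thesis
    using assms(2) D(2) by (auto simp: connection_form_def riemannian_metric_def)
qed

text \<open>The coordinate expression of \<open>[v\<^sub>i, v\<^sub>j] = \<delta>\<^sub>i\<^sub>1 v\<^sub>j - \<delta>\<^sub>j\<^sub>1 v\<^sub>i\<close>.  It follows from torsion-freeness,
  because the connection forms make \<open>\<delta>\<^sub>i\<^sub>j v\<^sub>1 - \<delta>\<^sub>j\<^sub>1 v\<^sub>i\<close> the covariant derivative of \<open>v\<^sub>j\<close> along \<open>v\<^sub>i\<close>.\<close>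

lemma frame_bracket:
  assumes A: "smooth_atlas A" "(U, \<phi>) \<in> A" and g: "riemannian_metric A g" "levi_civita A g nabla"
    and v: "orthonormal_frame A g D v" "dual_forms A D v \<theta>"
    and q: "q \<in> D" "q \<in> U"
    and conn: "\<And>i j w. w \<in> tangent_space A q \<Longrightarrow> connection_form g nabla v i j q w =
      (if j = i1 then \<theta> i q w else 0) - (if i = i1 then \<theta> j q w else 0)"
  defines "a \<equiv> \<lambda>i. chart_components (U, \<phi>) (v i)"
  shows "frechet_derivative (a j) (at (\<phi> q)) (a i (\<phi> q)) - frechet_derivative (a i) (at (\<phi> q)) (a j (\<phi> q)) =
    (if i = i1 then a j (\<phi> q) else 0) - (if j = i1 then a i (\<phi> q) else 0)"
proof -
  have vf: "vector_field A D (v i)" for i using v(1) by (simp add: orthonormal_frame_def)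
  have at: "vector_field_at A q (v i)" for i using vf q(1) by (auto simp: vector_field_at_def)
  have tan: "v i q \<in> tangent_space A q" for i using vf q(1) by (auto simp: vector_field_def)
  have "\<exists>u. nabla q (v i q) (v j) = chart_vector A (U, \<phi>) q u" for i j
  proof -
    have "nabla q (v i q) (v j) \<in> tangent_space A q"
      using g(2) at tan by (auto simp: levi_civita_def affine_connection_def)
    then show ?thesis using tangent_space_eq_range_chart_vector[OF A q(2)] by auto
  qed
  then obtain z where z: "\<And>i j. nabla q (v i q) (v j) = chart_vector A (U, \<phi>) q (z i j)" by metis
  let ?t = "\<lambda>k. form_components A (U, \<phi>) (\<theta> k) (\<phi> q)" and ?a = "\<lambda>i. a i (\<phi> q)"
  have dual: "?t i \<bullet> ?a j = (if i = j then 1 else 0)" for i j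
    unfolding a_def by (rule frame_components_dual[OF A v q])
  \<comment> \<open>the covariant derivatives of the frame, read off from the connection forms\<close>
  have z_eq: "z i j = (if i = j then ?a i1 else 0) - (if j = i1 then ?a i else 0)" for i j
  proof -
    have tz: "?t k \<bullet> z i j = (if k = i1 \<and> i = j then 1 else 0) - (if j = i1 \<and> i = k then 1 else 0)" for k
    proof -
      have "one_form A D (\<theta> k)" using v(2) by (simp add: dual_forms_def)
      from form_components_inner[OF A this q]
      have "?t k \<bullet> z i j = \<theta> k q (nabla q (v i q) (v j))" by (simp add: z)
      also have "\<dots> = connection_form g nabla v j k q (v i q)"
        unfolding connection_form_def
        by (rule dual_form_eq_metric[OF A(1) g(1) v q(1)])
          (use tangent_space_eq_range_chart_vector[OF A q(2)] z in auto)
      also have "\<dots> = (if k = i1 \<and> i = j then 1 else 0) - (if j = i1 \<and> i = k then 1 else 0)"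
        using v(2) q(1) by (auto simp: conn[OF tan] dual_forms_def)
      finally show ?thesis .
    qed
    have "z i j = (\<Sum>k\<in>UNIV. (?t k \<bullet> z i j) *\<^sub>R ?a k)"
      by (rule dual_basis_expansion[OF dual, symmetric])
    also have "\<dots> = (\<Sum>k\<in>UNIV. (?t k \<bullet> ((if i = j then ?a i1 else 0) - (if j = i1 then ?a i else 0))) *\<^sub>R ?a k)"
      by (rule sum.cong[OF refl]) (auto simp: tz inner_diff_right dual)
    also have "\<dots> = (if i = j then ?a i1 else 0) - (if j = i1 then ?a i else 0)"
      by (rule dual_basis_expansion[OF dual])
    finally show ?thesis .
  qed
  have "lie_bracket A (v i) (v j) q = tdiff (nabla q (v i q) (v j)) (nabla q (v j q) (v i))"
    using g(2) at by (auto simp: levi_civita_def)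
  also have "\<dots> = chart_vector A (U, \<phi>) q (z i j - z j i)"
    by (simp add: z chart_vector_diff[OF A(2) q(2)])
  finally have "(frechet_derivative (a j) (at (\<phi> q)) (?a i) - frechet_derivative (a i) (at (\<phi> q)) (?a j)) $ k =
      (z i j - z j i) $ k" for k
    using lie_bracket_coordinate[OF A vf vf q, of i j k] chart_vector_coordinate[OF A q(2)]
    unfolding a_def by metis
  then show ?thesis by (auto simp: vec_eq_iff z_eq)
qed

text \<open>The hypotheses on the connection forms and skew-symmetry in one formula, valid for all pairs of indices.\<close>

lemma connection_form_uniform:
  fixes v :: "'n::finite \<Rightarrow> 'm::{t2_space, second_countable_topology} vfield"
  assumes "smooth_atlas A" "riemannian_metric A g" "levi_civita A g nabla" "orthonormal_frame A g D v"
    "p \<in> D" "w \<in> tangent_space A p"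
    and one: "\<And>i. i \<noteq> i1 \<Longrightarrow> connection_form g nabla v i1 i p w + \<theta> i p w = 0"
    and other: "\<And>i j. i \<noteq> j \<Longrightarrow> i \<noteq> i1 \<Longrightarrow> j \<noteq> i1 \<Longrightarrow> connection_form g nabla v i j p w = 0"
  shows "connection_form g nabla v i j p w =
    (if j = i1 then \<theta> i p w else 0) - (if i = i1 then \<theta> j p w else 0)"
proof -
  note skew = connection_form_skew[OF assms(1-6)]
  consider "i = j" | "i \<noteq> j" "i = i1" | "i \<noteq> j" "j = i1" | "i \<noteq> j" "i \<noteq> i1" "j \<noteq> i1" by blast
  then show ?thesis
  proof cases
    case 1
    then show ?thesis using skew[of i i] by simp
  next
    case 2
    then show ?thesis using one[of j] by auto
  next
    case 3
    then show ?thesis using one[of i] skew[of i j] by auto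
  next
    case 4
    then show ?thesis using other by auto
  qed
qed

theorem theorem3:
  fixes A :: "('m::{t2_space, second_countable_topology}, 'n::finite) chart set"
    and g :: "'m metric"
    and nabla :: "'m connection"
    and D :: "'m set"
    and v :: "'n \<Rightarrow> 'm vfield"
    and \<theta> :: "'n \<Rightarrow> 'm \<Rightarrow> 'm tvec \<Rightarrow> real"
    and i1 :: 'n \<comment> \<open>the index playing the role of 1; the remaining indices are those with \<open>i \<ge> 2\<close>\<close>
  assumes "CARD('n) \<ge> 2"
    and "riemannian_manifold A g"
    and "levi_civita A g nabla"
    and "constant_sectional_curvature A g nabla (-1)"
    and "orthonormal_frame A g D v"
    and "dual_forms A D v \<theta>"
    and "CARD('n) = 2 \<Longrightarrow>
      \<forall>p\<in>D. \<forall>w\<in>tangent_space A p. \<forall>i. i \<noteq> i1 \<longrightarrow>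
        connection_form g nabla v i1 i p w + \<theta> i p w = 0"
    and "CARD('n) > 2 \<Longrightarrow>
      \<forall>p\<in>D. \<forall>w\<in>tangent_space A p.
        (\<forall>i. i \<noteq> i1 \<longrightarrow> connection_form g nabla v i1 i p w + \<theta> i p w = 0) \<and>
        (\<forall>i j. i \<noteq> j \<and> i \<noteq> i1 \<and> j \<noteq> i1 \<longrightarrow> connection_form g nabla v i j p w = 0)"
  shows "\<forall>p\<in>D. \<exists>W y (r :: 'n \<Rightarrow> real \<Rightarrow> real).
    coordinate_chart A (W, y) \<and> p \<in> W \<and> W \<subseteq> D \<and>
    (\<forall>q\<in>W. coord_vector A (W, y) i1 q = v i1 q \<and>
      (\<forall>i. i \<noteq> i1 \<longrightarrow> coord_vector A (W, y) i q = tscale (r i (y q $ i1)) (v i q)))"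
proof
  fix p assume p: "p \<in> D"
  have A: "smooth_atlas A" and g: "riemannian_metric A g"
    using assms(2) by (auto simp: riemannian_manifold_def)
  have vf: "vector_field A D (v i)" for i using assms(5) by (simp add: orthonormal_frame_def)
  have D: "open D" "D \<subseteq> carrier_of A" using vf by (auto simp: vector_field_def)
  have conn: "connection_form g nabla v i j q w =
      (if j = i1 then \<theta> i q w else 0) - (if i = i1 then \<theta> j q w else 0)"
    if qw: "q \<in> D" "w \<in> tangent_space A q" for i j q w
  proof (rule connection_form_uniform[OF A g assms(3,5) qw])
    have card: "CARD('n) = 2 \<or> CARD('n) > 2" using assms(1) by linarith
    then show "connection_form g nabla v i1 i q w + \<theta> i q w = 0" if "i \<noteq> i1" for i
      using assms(7,8) qw that by blast
    fix i j assume ij: "i \<noteq> j" "i \<noteq> i1" "j \<noteq> i1"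
    \<comment> \<open>three distinct indices exist only in dimension greater than 2\<close>
    then have "card {i, j, i1} = 3" by simp
    then have "CARD('n) > 2" using card_mono[of UNIV "{i, j, i1}"] by simp
    then show "connection_form g nabla v i j q w = 0" using assms(8) qw ij by blast
  qed
  obtain U \<phi> where U: "(U, \<phi>) \<in> A" "p \<in> U" using p D(2) by (auto simp: carrier_of_def)
  note inv = is_chartD(4)[OF smooth_atlasD(1)[OF A U(1)]]
  let ?E = "\<phi> ` (D \<inter> U)"
  define a where "a = (\<lambda>i. chart_components (U, \<phi>) (v i))"
  define t where "t = (\<lambda>i. form_components A (U, \<phi>) (\<theta> i))"
  have E: "open ?E" "\<phi> p \<in> ?E"
    using is_chart_open_image(2)[OF smooth_atlasD(1)[OF A U(1)] D(1)] p U(2) by auto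
  have smooth: "smooth_on ?E (a i)" "smooth_on ?E (t i)" for i
    using smooth_on_chart_components[OF A U(1) vf] smooth_on_form_components[OF A U(1)] assms(6)
    by (auto simp: a_def t_def dual_forms_def)
  have dual: "t i x \<bullet> a j x = (if i = j then 1 else 0)" if "x \<in> ?E" for i j x
    using that frame_components_dual[OF A U(1) assms(5,6)] by (auto simp: a_def t_def)
  have bracket: "frechet_derivative (a j) (at x) (a i x) - frechet_derivative (a i) (at x) (a j x) =
      (if i = i1 then a j x else 0) - (if j = i1 then a i x else 0)" if "x \<in> ?E" for i j x
    using that frame_bracket[OF A U(1) g assms(3,5,6) _ _ conn] unfolding a_def by blast
  obtain N V Y F where N: "open N" "\<phi> p \<in> N" "N \<subseteq> ?E" "open V" "homeomorphism N V Y F"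
      "smooth_on N Y" "smooth_on V F"
    and F: "\<And>z i. z \<in> V \<Longrightarrow> frechet_derivative F (at z) (axis i 1) =
      (if i = i1 then 1 else exp (- (z $ i1))) *\<^sub>R a i (F z)"
    using frame_coordinates[OF E smooth dual bracket] by metis
  define W where "W = inv_into U \<phi> ` N"
  have NU: "N \<subseteq> \<phi> ` U" using N(3) by blast
  note W = coordinate_chart_compose[OF A U(1) N(1) NU N(4-7), folded W_def]
  have "p \<in> W" using N(2) inv[OF U(2)] by (metis W_def imageI)
  have WD: "W \<subseteq> D" using N(3) inv by (force simp: W_def)
  have coord: "coord_vector A (W, Y \<circ> \<phi>) i q =
      tscale (if i = i1 then 1 else exp (- ((Y \<circ> \<phi>) q $ i1))) (v i q)" if q: "q \<in> W" for i q
  proof -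
    have qU: "q \<in> U" "q \<in> D" using q W(2) WD by auto
    have "coord_vector A (W, Y \<circ> \<phi>) i q = chart_vector A (U, \<phi>) q
        ((if i = i1 then 1 else exp (- (Y (\<phi> q) $ i1))) *\<^sub>R a i (\<phi> q))"
      unfolding coord_vector_def W(4)[OF q] F[OF W(5)[OF q]] W(6)[OF q] ..
    then show ?thesis
      using chart_vector_components[OF A U(1) vf qU(2,1), of i]
      by (simp add: chart_vector_scale[OF U(1) qU(1)] a_def)
  qed
  show "\<exists>W y (r :: 'n \<Rightarrow> real \<Rightarrow> real).
    coordinate_chart A (W, y) \<and> p \<in> W \<and> W \<subseteq> D \<and>
    (\<forall>q\<in>W. coord_vector A (W, y) i1 q = v i1 q \<and>
      (\<forall>i. i \<noteq> i1 \<longrightarrow> coord_vector A (W, y) i q = tscale (r i (y q $ i1)) (v i q)))"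
  proof (intro exI[of _ W] exI[of _ "Y \<circ> \<phi>"] exI[of _ "\<lambda>i s. exp (- s)"] conjI ballI allI impI)
    show "coord_vector A (W, Y \<circ> \<phi>) i1 q = v i1 q" if "q \<in> W" for q
      using coord[OF that, of i1] by (simp add: tscale_def)
  qed (use W(1) \<open>p \<in> W\<close> WD coord in auto)
qed

end
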